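(* Let $m=2$ and $n\ge 1$. (1) If a totally irrational $\boldsymbol{\xi}\in\mathbb{R}^{n\times 2}$ satisfies property (B) or property (C), then $\hat\omega(\boldsymbol{\xi})\le 2$. (2) If a totally irrational $\boldsymbol{\xi}\in\mathbb{R}^{n\times 2}$ satisfies properties (B) and (C) simultaneously, and moreover the two-dimensional subspace $\mathfrak{L}_{\boldsymbol{\xi}}=\{(\boldsymbol{x},\boldsymbol{y})^\top:\boldsymbol{x}\in\mathbb{R}^2,\boldsymbol{y}\in\mathbb{R}^n,\ \boldsymbol{y}=\boldsymbol{\xi}\boldsymbol{x}\}\subset\mathbb{R}^{2+n}$ is not contained in any three-dimensional rational linear subspace of $\mathbb{R}^{2+n}$, then $\hat\omega(\boldsymbol{\xi})\le 4/3$.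
   Context: All norms are sup-norms. For $\mathbf{x}=(\boldsymbol{x},\boldsymbol{y})\in\mathbb{Z}^{2+n}$ put $L_{\boldsymbol{\xi}}(\mathbf{x})=\|\boldsymbol{\xi}\boldsymbol{x}-\boldsymbol{y}\|$; $\boldsymbol{\xi}$ is totally irrational if $L_{\boldsymbol{\xi}}(\mathbf{x})>0$ for all nonzero integer $\mathbf{x}$. The step function $X\mapsto\min\{L_{\boldsymbol{\xi}}(\boldsymbol{x},\boldsymbol{y}): 0<\|\boldsymbol{x}\|\le X\}$ (minimum over integer vectors) has successive jump points $1=X_1<X_2<\cdots$ and value $L_i$ on $[X_i,X_{i+1})$. (B): $\sup_iX_{i+1}/X_i<\infty$. (C): $\sup_iL_i/L_{i+1}<\infty$. A rational linear subspace is one spanned by vectors with rational coordinates. The uniform exponent $\hat\omega(\boldsymbol{\xi})$ is the supremum of $w$ such that $L_{\boldsymbol{\xi}}(\mathbf{x})<X^{-w}$, $0<\|\boldsymbol{x}\|\le X$ has an integer solution for all sufficiently large $X$; equivalently $\hat\omega(\boldsymbol{\xi})=\liminf_i(-\log L_i)/\log X_{i+1}$. *)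

theory Defs
  imports "HOL-Analysis.Analysis"
begin

text \<open>
  The sup-norm is \<^const>\<open>infnorm\<close>; \<^const>\<open>norm\<close> on \<^typ>\<open>real^'n\<close> is the Euclidean norm.
  An n-by-2 matrix has type \<^typ>\<open>real^2^'n\<close>, and the ambient space of dimension 2 + n is
  \<^typ>\<open>(real^2) \<times> (real^'n)\<close>.
\<close>

definition rvec :: "int^'k \<Rightarrow> real^'k" where
  "rvec v = (\<chi> i. of_int (v $ i))"

definition lin_form :: "real^2^'n \<Rightarrow> int^2 \<Rightarrow> int^'n \<Rightarrow> real" where
  "lin_form \<xi> x y = infnorm (\<xi> *v rvec x - rvec y)"

definition totally_irrational :: "real^2^'n \<Rightarrow> bool" where
  "totally_irrational \<xi> \<longleftrightarrow> (\<forall>x y. (x, y) \<noteq> (0, 0) \<longrightarrow> lin_form \<xi> x y > 0)"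

text \<open>
  For \<open>X \<ge> 1\<close> the infimum is a minimum: only finitely many x occur, and for each of them the
  values over y form a closed discrete set. For \<open>X < 1\<close> the set is empty and the value is
  irrelevant.
\<close>

definition min_fun :: "real^2^'n \<Rightarrow> real \<Rightarrow> real" where
  "min_fun \<xi> X = Inf {lin_form \<xi> x y | x y. 0 < infnorm (rvec x) \<and> infnorm (rvec x) \<le> X}"

text \<open>
  Indices are shifted by one: \<open>jump_point \<xi> i\<close> is \<open>X\<^sub>i\<^sub>+\<^sub>1\<close>. The step function is constant between
  consecutive integers, so its discontinuities beyond 1 are integers; if the matrix is totally
  irrational, there are infinitely many of them, hence the least one after a given point exists.
\<close>

primrec jump_point :: "real^2^'n \<Rightarrow> nat \<Rightarrow> real" where
  "jump_point \<xi> 0 = 1"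
| "jump_point \<xi> (Suc i) = (LEAST X. jump_point \<xi> i < X \<and> \<not> isCont (min_fun \<xi>) X)"

definition jump_value :: "real^2^'n \<Rightarrow> nat \<Rightarrow> real" where
  "jump_value \<xi> i = min_fun \<xi> (jump_point \<xi> i)"

definition property_B :: "real^2^'n \<Rightarrow> bool" where
  "property_B \<xi> \<longleftrightarrow> bdd_above (range (\<lambda>i. jump_point \<xi> (Suc i) / jump_point \<xi> i))"

definition property_C :: "real^2^'n \<Rightarrow> bool" where
  "property_C \<xi> \<longleftrightarrow> bdd_above (range (\<lambda>i. jump_value \<xi> i / jump_value \<xi> (Suc i)))"

text \<open>The exponent may be infinite, so the supremum is taken in the extended reals.\<close>

definition uniform_exponent :: "real^2^'n \<Rightarrow> ereal" where
  "uniform_exponent \<xi> = Sup {ereal w | w. \<forall>\<^sub>F X in at_top. \<exists>x y.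
     0 < infnorm (rvec x) \<and> infnorm (rvec x) \<le> X \<and> lin_form \<xi> x y < X powr (- w)}"

definition graph_space :: "real^2^'n \<Rightarrow> ((real^2) \<times> (real^'n)) set" where
  "graph_space \<xi> = {(x, y). y = \<xi> *v x}"

definition rational_subspace :: "((real^2) \<times> (real^'n)) set \<Rightarrow> bool" where
  "rational_subspace S \<longleftrightarrow>
     (\<exists>B. (\<forall>(x, y)\<in>B. (\<forall>i. x $ i \<in> \<rat>) \<and> (\<forall>j. y $ j \<in> \<rat>)) \<and> S = span B)"

end

theory Submission
  imports Defs
begin

text \<open>
  Let \<open>z\<^sub>i\<close> be the minimal points, with heights \<open>X\<^sub>i\<close> and errors \<open>L\<^sub>i\<close>. An exponent \<open>w\<close> gives
  \<open>L\<^sub>i \<lless> X\<^sub>i\<^sub>+\<^sub>1\<close> to the power \<open>-w\<close>. If \<open>w > 1\<close>, then \<open>X\<^sub>i\<^sub>+\<^sub>1 L\<^sub>i\<close> tends to 0, and any subspace that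
  contains all late minimal points contains the graph. Hence infinitely many consecutive triples are
  linearly independent. A nonzero integer minor of such a triple gives
  \<open>1 \<lless> L\<^sub>i X\<^sub>i\<^sub>+\<^sub>1 X\<^sub>i\<^sub>+\<^sub>2\<close>, which under (B) or (C) forces \<open>w \<le> 2\<close>.

  For the second part, take an independent triple starting at \<open>i\<close>, followed by a run of dependent
  triples up to \<open>j > i\<close>, such that \<open>z\<^sub>j\<^sub>+\<^sub>2\<close> leaves the span of the triple at \<open>i\<close>; such pairs exist
  arbitrarily far out because the graph lies in no rational space of dimension 3. Put
  \<open>a = X\<^sub>i\<^sub>+\<^sub>2\<close>, \<open>b = L\<^sub>i\<^sub>+\<^sub>1\<close>, \<open>Y = X\<^sub>j\<^sub>+\<^sub>1\<close>. Minors of orders 3 and 4 give \<open>1 \<lless> a a b\<close> and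
  \<open>1 \<lless> Y a b b\<close>, so \<open>1 \<lless> Y (a b)\<^sup>3\<close>. Along the run, consecutive minimal points are bases of one
  planar lattice, so their mixed minors of order 2 agree up to sign and \<open>X\<^sub>l\<^sub>+\<^sub>1 L\<^sub>l\<close> stays
  constant up to a bounded factor. Therefore \<open>a b \<lless> Y L\<^sub>j\<close>, which is at most a constant times \<open>Y\<close>
  to the power \<open>1 - w\<close>, and \<open>4 - 3 w \<ge> 0\<close>.
\<close>

subsection \<open>The step function\<close>

definition int_points :: "((real^2) \<times> (real^'n)) set" where
  "int_points = {(rvec x, rvec y) | x y. True}"

definition ht :: "(real^2) \<times> (real^'n) \<Rightarrow> real" where
  "ht p = infnorm (fst p)"

text \<open>\<open>lin_form\<close> extended to real points, so that real combinations of lattice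
  points can be estimated as well.\<close>

definition err :: "real^2^'n \<Rightarrow> (real^2) \<times> (real^'n) \<Rightarrow> real" where
  "err \<xi> p = infnorm (\<xi> *v fst p - snd p)"

lemma infnorm_attained:
  fixes x :: "real^'k"
  obtains i where "infnorm x = \<bar>x $ i\<bar>"
proof -
  have "infnorm x = Max (range (\<lambda>i. \<bar>x $ i\<bar>))"
    unfolding infnorm_cart by (subst cSup_eq_Max) (auto simp: full_SetCompr_eq)
  moreover have "Max (range (\<lambda>i. \<bar>x $ i\<bar>)) \<in> range (\<lambda>i. \<bar>x $ i\<bar>)"
    by (rule Max_in) auto
  ultimately show thesis using that by (metis imageE)
qed

lemma infnorm_le_iff:
  fixes x :: "real^'k"
  shows "infnorm x \<le> B \<longleftrightarrow> (\<forall>i. \<bar>x $ i\<bar> \<le> B)"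
  by (metis infnorm_attained component_le_infnorm_cart order_trans)

lemma infnorm_less_iff:
  fixes x :: "real^'k"
  shows "infnorm x < B \<longleftrightarrow> (\<forall>i. \<bar>x $ i\<bar> < B)"
  by (metis infnorm_attained component_le_infnorm_cart order_le_less_trans)

lemma rvec_0 [simp]: "rvec 0 = 0"
  by (simp add: rvec_def vec_eq_iff)

lemma infnorm_rvec_int: "infnorm (rvec v) \<in> \<int>"
  by (rule infnorm_attained[of "rvec v"]) (auto simp: rvec_def)

lemma finite_int_vectors_near:
  fixes a :: "real^'k"
  shows "finite {v :: int^'k. infnorm (a - rvec v) \<le> B}"
proof -
  define A where "A = (\<lambda>i. {\<lceil>a $ i - B\<rceil>..\<lfloor>a $ i + B\<rfloor>})"
  have "{v :: int^'k. infnorm (a - rvec v) \<le> B} \<subseteq> vec_lambda ` (Pi\<^sub>E UNIV A)"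
  proof
    fix v :: "int^'k" assume "v \<in> {v. infnorm (a - rvec v) \<le> B}"
    hence "\<bar>a $ i - of_int (v $ i)\<bar> \<le> B" for i
      by (auto simp: infnorm_le_iff rvec_def)
    hence "vec_nth v \<in> Pi\<^sub>E UNIV A"
      unfolding A_def by (auto simp: abs_le_iff ceiling_le_iff le_floor_iff algebra_simps)
    thus "v \<in> vec_lambda ` (Pi\<^sub>E UNIV A)"
      by (metis image_eqI vec_nth_inverse)
  qed
  moreover have "finite (Pi\<^sub>E UNIV A)"
    by (rule finite_PiE) (auto simp: A_def)
  ultimately show ?thesis by (meson finite_imageI finite_subset)
qed

lemma lin_form_nonneg: "0 \<le> lin_form \<xi> x y"
  by (simp add: lin_form_def infnorm_pos_le)

lemma min_fun_le:
  assumes "0 < infnorm (rvec x)" "infnorm (rvec x) \<le> X"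
  shows "min_fun \<xi> X \<le> lin_form \<xi> x y"
  unfolding min_fun_def
  by (rule cInf_lower) (use assms in \<open>auto intro!: bdd_belowI[of _ 0] lin_form_nonneg\<close>)

lemma min_fun_attained:
  fixes \<xi> :: "real^2^'n"
  assumes "1 \<le> X"
  obtains x y where "0 < infnorm (rvec x)" "infnorm (rvec x) \<le> X" "lin_form \<xi> x y = min_fun \<xi> X"
proof -
  \<comment> \<open>The vector (1,1) has sup-norm 1 and so is admissible for every \<open>X\<close>
    \<ge> 1. Its value with \<open>y = 0\<close> caps the competitors and leaves the finite set
    \<open>P\<close>.\<close>
  define e :: "int^2" where "e = (\<chi> i. 1)"
  have e: "infnorm (rvec e) = 1"
    by (rule infnorm_attained[of "rvec e"]) (simp add: e_def rvec_def)
  define P where "P = (SIGMA x:{x :: int^2. 0 < infnorm (rvec x) \<and> infnorm (rvec x) \<le> X}.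
    {y :: int^'n. lin_form \<xi> x y \<le> lin_form \<xi> e 0})"
  have "finite {x :: int^2. infnorm (0 - rvec x) \<le> X}"
    by (rule finite_int_vectors_near)
  hence "finite {x :: int^2. 0 < infnorm (rvec x) \<and> infnorm (rvec x) \<le> X}"
    by (rule rev_finite_subset) (auto simp: infnorm_neg)
  hence fin: "finite P"
    unfolding P_def lin_form_def by (intro finite_SigmaI finite_int_vectors_near)
  have e_in: "(e, 0) \<in> P" using e assms by (simp add: P_def)
  obtain p where p: "p \<in> P" "\<And>q. q \<in> P \<Longrightarrow> case_prod (lin_form \<xi>) p \<le> case_prod (lin_form \<xi>) q"
    using ex_min_if_finite[of "case_prod (lin_form \<xi>) ` P"] fin e_in
    by (metis (no_types, lifting) arg_min_if_finite(1) arg_min_least empty_iff)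
  obtain x y where xy: "p = (x, y)" by (cases p)
  have "min_fun \<xi> X = lin_form \<xi> x y"
    unfolding min_fun_def
  proof (rule cInf_eq_minimum)
    show "lin_form \<xi> x y \<in> {lin_form \<xi> x y |x y. 0 < infnorm (rvec x) \<and> infnorm (rvec x) \<le> X}"
      using p(1) by (auto simp: xy P_def)
  next
    fix r assume "r \<in> {lin_form \<xi> x y |x y. 0 < infnorm (rvec x) \<and> infnorm (rvec x) \<le> X}"
    then obtain x' y' where r: "r = lin_form \<xi> x' y'" "0 < infnorm (rvec x')" "infnorm (rvec x') \<le> X"
      by auto
    show "lin_form \<xi> x y \<le> r"
    proof (cases "r \<le> lin_form \<xi> e 0")
      case True
      thus ?thesis using p(2)[of "(x', y')"] r by (simp add: xy P_def)
    next
      case False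
      thus ?thesis using p(2)[OF e_in] by (simp add: xy)
    qed
  qed
  with p(1) show thesis by (intro that[of x y]) (auto simp: xy P_def)
qed

lemma min_fun_antimono:
  assumes "1 \<le> X" "X \<le> Y"
  shows "min_fun \<xi> Y \<le> min_fun \<xi> X"
  by (rule min_fun_attained[OF assms(1), of \<xi>]) (metis min_fun_le assms(2) order_trans)

text \<open>Integer vectors have integer sup-norm, so \<open>X\<close> and its floor admit the same
  vectors.\<close>

lemma min_fun_floor:
  assumes "1 \<le> X"
  shows "min_fun \<xi> (real (nat \<lfloor>X\<rfloor>)) = min_fun \<xi> X"
proof -
  have "infnorm (rvec x) \<le> X \<longleftrightarrow> infnorm (rvec x) \<le> real (nat \<lfloor>X\<rfloor>)" for x :: "int^2"
    using infnorm_rvec_int[of x] assms by (auto elim!: Ints_cases simp: le_floor_iff)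
  thus ?thesis unfolding min_fun_def by simp
qed

lemma min_fun_pos:
  assumes "totally_irrational \<xi>" "1 \<le> X"
  shows "0 < min_fun \<xi> X"
proof -
  obtain x y where xy: "0 < infnorm (rvec x)" "lin_form \<xi> x y = min_fun \<xi> X"
    using min_fun_attained[OF assms(2)] by metis
  have "x \<noteq> 0"
    using xy(1) by (auto simp: infnorm_0)
  thus ?thesis
    using assms(1) xy(2) unfolding totally_irrational_def by (metis prod.inject)
qed

text \<open>This makes the \<open>LEAST\<close> over the reals in \<open>jump_point\<close>
  meaningful. The next discontinuity is the least integer \<open>M\<close> > \<open>N\<close> whose
  value differs from that at \<open>N\<close>; it exists because the values are positive and tend to
  0.\<close>

lemma next_jump:
  fixes \<xi> :: "real^2^'n"
  assumes "totally_irrational \<xi>" and lim: "(min_fun \<xi> \<longlongrightarrow> 0) at_top" and "1 \<le> N"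
  obtains M where "N < M" "(LEAST X. real N < X \<and> \<not> isCont (min_fun \<xi>) X) = real M"
    "min_fun \<xi> (real M) < min_fun \<xi> (real N)"
    "\<forall>X. real N \<le> X \<longrightarrow> X < real M \<longrightarrow> min_fun \<xi> X = min_fun \<xi> (real N)"
proof -
  let ?f = "min_fun \<xi>"
  have pos: "0 < ?f (real N)" using assms by (intro min_fun_pos) auto
  have "\<forall>\<^sub>F X in at_top. ?f X < ?f (real N)"
    using order_tendstoD(2)[OF lim pos] .
  moreover have "\<forall>\<^sub>F X in at_top. real N < X" by (rule eventually_gt_at_top)
  ultimately have "\<forall>\<^sub>F X in at_top. ?f X < ?f (real N) \<and> real N < X"
    by (rule eventually_conj)
  then obtain X0 where X0: "\<And>X. X \<ge> X0 \<Longrightarrow> ?f X < ?f (real N) \<and> real N < X"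
    unfolding eventually_at_top_linorder by blast
  define Q where "Q = (\<lambda>M. N < M \<and> ?f (real M) \<noteq> ?f (real N))"
  have "Q (nat \<lceil>X0\<rceil>)"
    using X0[of "real (nat \<lceil>X0\<rceil>)"] unfolding Q_def by (auto simp: real_nat_ceiling_ge)
  define M where "M = Least Q"
  have "Q M" unfolding M_def by (rule LeastI) fact
  hence M: "N < M" "?f (real M) \<noteq> ?f (real N)" unfolding Q_def by auto
  have const: "?f X = ?f (real N)" if "real N \<le> X" "X < real M" for X
  proof -
    have X: "N \<le> nat \<lfloor>X\<rfloor>" "nat \<lfloor>X\<rfloor> < M"
      using that \<open>1 \<le> N\<close> by (auto simp: le_nat_floor) linarith
    hence "?f (real (nat \<lfloor>X\<rfloor>)) = ?f (real N)"
      using not_less_Least[of "nat \<lfloor>X\<rfloor>" Q] unfolding M_def Q_def by (metis le_neq_implies_less)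
    thus ?thesis using min_fun_floor[of X \<xi>] that \<open>1 \<le> N\<close> by simp
  qed
  have "(LEAST X. real N < X \<and> \<not> isCont ?f X) = real M"
  proof (rule Least_equality, intro conjI notI)
    show "real N < real M" using M by simp
    assume "isCont ?f (real M)"
    hence "(?f \<longlongrightarrow> ?f (real M)) (at_left (real M))"
      unfolding isCont_def by (rule tendsto_within_subset) simp
    moreover have "\<forall>\<^sub>F X in at_left (real M). ?f X = ?f (real N)"
      unfolding eventually_at_left_field
      by (intro exI[of _ "real N"] conjI allI impI const) (use M in auto)
    ultimately have "((\<lambda>_. ?f (real N)) \<longlongrightarrow> ?f (real M)) (at_left (real M))"
      by (rule Lim_transform_eventually)
    hence "?f (real N) = ?f (real M)"
      by (simp add: tendsto_const_iff)
    thus False using M by simp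
  next
    fix y assume y: "real N < y \<and> \<not> isCont ?f y"
    show "real M \<le> y"
    proof (rule ccontr)
      assume "\<not> real M \<le> y"
      hence "\<forall>\<^sub>F X in nhds y. ?f X = ?f (real N)"
        using y by (intro eventually_nhds_in_open[of "{real N<..<real M}", THEN eventually_mono] const) auto
      hence "isCont ?f y \<longleftrightarrow> isCont (\<lambda>_. ?f (real N)) y" by (rule isCont_cong)
      thus False using y by simp
    qed
  qed
  moreover have "?f (real M) \<le> ?f (real N)"
    using M \<open>1 \<le> N\<close> by (intro min_fun_antimono) auto
  ultimately show thesis using M(2) by (intro that[of M] M(1) allI impI const) auto
qed

subsection \<open>Minors of integer points\<close>

text \<open>Minors with rows given by functionals and columns by points, the larger ones expanded
  along the first row. Rows can thus be exchanged for other linear forms while the points stay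
  fixed.\<close>

definition det2 :: "('a \<Rightarrow> real) \<Rightarrow> ('a \<Rightarrow> real) \<Rightarrow> 'a \<Rightarrow> 'a \<Rightarrow> real" where
  "det2 f g u v = f u * g v - f v * g u"

definition det3 :: "('a \<Rightarrow> real) \<Rightarrow> ('a \<Rightarrow> real) \<Rightarrow> ('a \<Rightarrow> real) \<Rightarrow> 'a \<Rightarrow> 'a \<Rightarrow> 'a \<Rightarrow> real" where
  "det3 f g h u v w = f u * det2 g h v w - f v * det2 g h u w + f w * det2 g h u v"

definition det4 :: "('a \<Rightarrow> real) \<Rightarrow> ('a \<Rightarrow> real) \<Rightarrow> ('a \<Rightarrow> real) \<Rightarrow> ('a \<Rightarrow> real) \<Rightarrow>
    'a \<Rightarrow> 'a \<Rightarrow> 'a \<Rightarrow> 'a \<Rightarrow> real" where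
  "det4 f g h k u v w t = f u * det3 g h k v w t - f v * det3 g h k u w t
     + f w * det3 g h k u v t - f t * det3 g h k u v w"

text \<open>Standard coordinates of the ambient space: integral at integer points, so minors in them
  are integers.\<close>

definition point_coords :: "((real^2) \<times> (real^'n) \<Rightarrow> real) set" where
  "point_coords = range (\<lambda>k p. fst p $ k) \<union> range (\<lambda>j p. snd p $ j)"

text \<open>Replaces y by \<xi> x - y, so that all coordinates but the two of x are bounded by the
  error.\<close>

definition form_coords :: "real^2^'n \<Rightarrow> ((real^2) \<times> (real^'n) \<Rightarrow> real) set" where
  "form_coords \<xi> = range (\<lambda>k p. fst p $ k) \<union> range (\<lambda>j p. (\<xi> *v fst p - snd p) $ j)"

lemma point_coords_eqI: "(\<And>h. h \<in> point_coords \<Longrightarrow> h p = h q) \<Longrightarrow> p = q"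
  unfolding point_coords_def by (auto simp: prod_eq_iff vec_eq_iff)

lemma point_coords_lin:
  assumes "h \<in> point_coords"
  shows "h (a *\<^sub>R u + b *\<^sub>R v) = a * h u + b * h v"
  using assms unfolding point_coords_def by auto

lemma point_coords_lin3:
  assumes "h \<in> point_coords"
  shows "h (a *\<^sub>R u + b *\<^sub>R v + c *\<^sub>R w) = a * h u + b * h v + c * h w"
  using assms unfolding point_coords_def by auto

text \<open>If all minors vanish, one coordinate \<open>f\<close> with \<open>f u\<close> \<noteq> 0
  fixes the ratio \<open>f v / f u\<close>, and every other coordinate of \<open>v\<close> obeys
  it.\<close>

lemma det2_nonzero:
  fixes u v :: "(real^2) \<times> (real^'n)"
  assumes "u \<noteq> 0" "v \<notin> span {u}"
  obtains f g where "f \<in> point_coords" "g \<in> point_coords" "det2 f g u v \<noteq> 0"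
proof (rule ccontr)
  assume "\<not> thesis"
  hence z: "det2 f g u v = 0" if "f \<in> point_coords" "g \<in> point_coords" for f g
    using that \<open>\<And>g f. f \<in> point_coords \<Longrightarrow> g \<in> point_coords \<Longrightarrow> det2 f g u v \<noteq> 0 \<Longrightarrow> thesis\<close> by blast
  have "\<exists>f \<in> point_coords. f u \<noteq> 0"
  proof (rule ccontr)
    assume "\<not> ?thesis"
    hence "u = 0" by (intro point_coords_eqI) (auto simp: point_coords_def)
    with assms show False by simp
  qed
  then obtain f where f: "f \<in> point_coords" "f u \<noteq> 0" by blast
  \<comment> \<open>The summand \<open>0 *\<^sub>R u\<close> only brings the multiple into the shape
    of \<open>point_coords_lin\<close>.\<close>
  have "v = (f v / f u) *\<^sub>R u + 0 *\<^sub>R u"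
  proof (rule point_coords_eqI)
    fix g :: "(real^2) \<times> (real^'n) \<Rightarrow> real" assume g: "g \<in> point_coords"
    show "g v = g ((f v / f u) *\<^sub>R u + 0 *\<^sub>R u)"
      using z[OF f(1) g] f(2) unfolding point_coords_lin[OF g] det2_def
      by (simp add: field_simps)
  qed
  hence "v \<in> span {u}"
    by (metis add_0_right insertI1 scaleR_zero_left span_base span_scale)
  with assms show False by simp
qed

text \<open>Cramer's rule: if the determinant is 0, expanding along the row \<open>h\<close> and
  dividing by the fixed minor \<open>det2 f g u v\<close> writes \<open>h w\<close> as a combination
  of \<open>h u\<close> and \<open>h v\<close> with coefficients independent of \<open>h\<close>. If
  this happens for all \<open>h\<close>, then \<open>w\<close> lies in the span.\<close>

lemma det3_nonzero:
  fixes u v w :: "(real^2) \<times> (real^'n)"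
  assumes "f \<in> point_coords" "g \<in> point_coords" "det2 f g u v \<noteq> 0" "w \<notin> span {u, v}"
  obtains h where "h \<in> point_coords" "det3 h f g u v w \<noteq> 0"
proof (rule ccontr)
  assume "\<not> thesis"
  hence z: "det3 h f g u v w = 0" if "h \<in> point_coords" for h
    using that \<open>\<And>h. h \<in> point_coords \<Longrightarrow> det3 h f g u v w \<noteq> 0 \<Longrightarrow> thesis\<close> by blast
  define D where "D = det2 f g u v"
  have "w = (- det2 f g v w / D) *\<^sub>R u + (det2 f g u w / D) *\<^sub>R v"
  proof (rule point_coords_eqI)
    fix h :: "(real^2) \<times> (real^'n) \<Rightarrow> real" assume h: "h \<in> point_coords"
    show "h w = h ((- det2 f g v w / D) *\<^sub>R u + (det2 f g u w / D) *\<^sub>R v)"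
      using z[OF h] assms(3) unfolding point_coords_lin[OF h] det3_def D_def[symmetric]
      by (simp add: field_simps)
  qed
  hence "w \<in> span {u, v}"
    by (metis insertI1 insertI2 span_add span_base span_scale)
  with assms show False by simp
qed

text \<open>The same bordering argument one dimension up, with \<open>det3 f g h u v w\<close> as
  the fixed minor.\<close>

lemma det4_nonzero:
  fixes u v w t :: "(real^2) \<times> (real^'n)"
  assumes "f \<in> point_coords" "g \<in> point_coords" "h \<in> point_coords" "det3 f g h u v w \<noteq> 0"
    "t \<notin> span {u, v, w}"
  obtains k where "k \<in> point_coords" "det4 k f g h u v w t \<noteq> 0"
proof (rule ccontr)
  assume "\<not> thesis"
  hence z: "det4 k f g h u v w t = 0" if "k \<in> point_coords" for k
    using that \<open>\<And>k. k \<in> point_coords \<Longrightarrow> det4 k f g h u v w t \<noteq> 0 \<Longrightarrow> thesis\<close> by blast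
  define D where "D = det3 f g h u v w"
  have "t = (det3 f g h v w t / D) *\<^sub>R u + (- det3 f g h u w t / D) *\<^sub>R v
      + (det3 f g h u v t / D) *\<^sub>R w"
  proof (rule point_coords_eqI)
    fix k :: "(real^2) \<times> (real^'n) \<Rightarrow> real" assume k: "k \<in> point_coords"
    show "k t = k ((det3 f g h v w t / D) *\<^sub>R u + (- det3 f g h u w t / D) *\<^sub>R v
      + (det3 f g h u v t / D) *\<^sub>R w)"
      using z[OF k] assms(4) unfolding point_coords_lin3[OF k] det4_def D_def[symmetric]
      by (simp add: field_simps)
  qed
  hence "t \<in> span {u, v, w}"
    by (metis insertI1 insertI2 span_add span_base span_scale)
  with assms show False by simp
qed

lemma det2_in_Ints:
  assumes "f u \<in> \<int>" "f v \<in> \<int>" "g u \<in> \<int>" "g v \<in> \<int>"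
  shows "det2 f g u v \<in> \<int>"
  unfolding det2_def using assms by (intro Ints_diff Ints_mult)

lemma point_coords_Ints: "h \<in> point_coords \<Longrightarrow> p \<in> int_points \<Longrightarrow> h p \<in> \<int>"
  unfolding point_coords_def int_points_def by (auto simp: rvec_def)

lemma det3_in_Ints:
  assumes "f \<in> point_coords" "g \<in> point_coords" "h \<in> point_coords"
    "u \<in> int_points" "v \<in> int_points" "w \<in> int_points"
  shows "det3 f g h u v w \<in> \<int>"
  unfolding det3_def using assms
  by (intro Ints_diff Ints_add Ints_mult det2_in_Ints point_coords_Ints)

lemma det4_in_Ints:
  assumes "f \<in> point_coords" "g \<in> point_coords" "h \<in> point_coords" "k \<in> point_coords"
    "u \<in> int_points" "v \<in> int_points" "w \<in> int_points" "t \<in> int_points"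
  shows "det4 f g h k u v w t \<in> \<int>"
  unfolding det4_def using assms
  by (intro Ints_diff Ints_add Ints_mult det3_in_Ints point_coords_Ints)

section \<open>Exchanging integral coordinates for the linear forms\<close>

lemma matrix_entries_bounded:
  fixes \<xi> :: "real^2^'n"
  obtains C where "1 \<le> C" "\<And>j k. \<bar>\<xi> $ j $ k\<bar> \<le> C"
proof
  define S where "S = (\<Sum>j\<in>UNIV. \<Sum>k\<in>UNIV. \<bar>\<xi> $ j $ k\<bar>)"
  show "1 \<le> 1 + S" unfolding S_def by (simp add: sum_nonneg)
  fix j :: 'n and k :: 2
  have "\<bar>\<xi> $ j $ k\<bar> \<le> (\<Sum>k\<in>UNIV. \<bar>\<xi> $ j $ k\<bar>)" by (rule member_le_sum) auto
  also have "\<dots> \<le> S" unfolding S_def by (rule member_le_sum) (auto intro: sum_nonneg)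
  finally show "\<bar>\<xi> $ j $ k\<bar> \<le> 1 + S" by simp
qed

text \<open>A coordinate of y is that of \<xi> x minus that of \<xi> x - y, a combination of three
  forms with two matrix entries and -1 as coefficients. A coordinate of x is itself a form and is
  padded with zero coefficients.\<close>

lemma point_coord_expansion:
  fixes \<xi> :: "real^2^'n"
  assumes "c \<in> point_coords" "1 \<le> C" "\<And>j k. \<bar>\<xi> $ j $ k\<bar> \<le> C"
  obtains p q r \<alpha> \<beta> \<gamma> where "p \<in> form_coords \<xi>" "q \<in> form_coords \<xi>" "r \<in> form_coords \<xi>"
    "\<bar>\<alpha>\<bar> \<le> C" "\<bar>\<beta>\<bar> \<le> C" "\<bar>\<gamma>\<bar> \<le> C" "c = (\<lambda>z. \<alpha> * p z + \<beta> * q z + \<gamma> * r z)"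
  using assms(1) unfolding point_coords_def
proof (elim UnE rangeE)
  fix k assume c: "c = (\<lambda>p. fst p $ k)"
  have "(\<lambda>p :: (real^2) \<times> (real^'n). fst p $ k) \<in> form_coords \<xi>" by (auto simp: form_coords_def)
  thus thesis
    using assms(2) by (intro that[of "\<lambda>p. fst p $ k" "\<lambda>p. fst p $ k" "\<lambda>p. fst p $ k" 1 0 0])
      (auto simp: c)
next
  fix j assume c: "c = (\<lambda>p. snd p $ j)"
  have "(\<lambda>p :: (real^2) \<times> (real^'n). fst p $ k) \<in> form_coords \<xi>" for k
    by (auto simp: form_coords_def)
  moreover have "(\<lambda>p. (\<xi> *v fst p - snd p) $ j) \<in> form_coords \<xi>" by (auto simp: form_coords_def)
  ultimately show thesis
    using assms(2,3)
    by (intro that[of "\<lambda>p. fst p $ 1" "\<lambda>p. fst p $ 2" "\<lambda>p. (\<xi> *v fst p - snd p) $ j"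
          "\<xi> $ j $ 1" "\<xi> $ j $ 2" "-1"])
      (auto simp: c matrix_vector_mult_def sum_2)
qed

text \<open>\<open>F\<close> stands for a minor as a function of one row, in which it is linear.
  Three terms with coefficients at most \<open>C\<close> give the factor 3C.\<close>

lemma linear_bound_on_point_coords:
  fixes \<xi> :: "real^2^'n"
  assumes lin: "\<And>p q r \<alpha> \<beta> \<gamma>. F (\<lambda>z. \<alpha> * p z + \<beta> * q z + \<gamma> * r z) = \<alpha> * F p + \<beta> * F q + \<gamma> * F r"
    and bound: "\<And>g. g \<in> form_coords \<xi> \<Longrightarrow> \<bar>F g\<bar> \<le> B"
    and "c \<in> point_coords" "1 \<le> C" "\<And>j k. \<bar>\<xi> $ j $ k\<bar> \<le> C"
  shows "\<bar>F c\<bar> \<le> (3 * C) * B"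
proof -
  obtain p q r \<alpha> \<beta> \<gamma> where pqr: "p \<in> form_coords \<xi>" "q \<in> form_coords \<xi>" "r \<in> form_coords \<xi>"
    "\<bar>\<alpha>\<bar> \<le> C" "\<bar>\<beta>\<bar> \<le> C" "\<bar>\<gamma>\<bar> \<le> C" "c = (\<lambda>z. \<alpha> * p z + \<beta> * q z + \<gamma> * r z)"
    by (rule point_coord_expansion[OF assms(3,4,5)])
  have "F c = \<alpha> * F p + \<beta> * F q + \<gamma> * F r"
    unfolding pqr(7) by (rule lin)
  hence "\<bar>F c\<bar> \<le> \<bar>\<alpha> * F p\<bar> + \<bar>\<beta> * F q\<bar> + \<bar>\<gamma> * F r\<bar>"
    by linarith
  also have "\<dots> \<le> C * B + C * B + C * B"
    unfolding abs_mult using pqr assms(4) by (intro add_mono mult_mono bound) auto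
  finally show ?thesis by (simp add: algebra_simps)
qed

text \<open>The rows are exchanged one at a time, the last one first, each at the cost of a factor
  3C. Larger minors are treated in the same way.\<close>

lemma det2_point_bound:
  fixes \<xi> :: "real^2^'n"
  assumes C: "1 \<le> C" "\<And>j k. \<bar>\<xi> $ j $ k\<bar> \<le> C"
    and B: "\<And>f g. f \<in> form_coords \<xi> \<Longrightarrow> g \<in> form_coords \<xi> \<Longrightarrow> \<bar>det2 f g u v\<bar> \<le> B"
    and "f \<in> point_coords" "g \<in> point_coords"
  shows "\<bar>det2 f g u v\<bar> \<le> (3 * C) * ((3 * C) * B)"
proof -
  have 1: "\<bar>det2 f g u v\<bar> \<le> (3 * C) * B" if "f \<in> form_coords \<xi>" for f
    by (rule linear_bound_on_point_coords[OF _ B[OF that] assms(5) C])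
      (simp_all add: det2_def algebra_simps)
  show ?thesis
    by (rule linear_bound_on_point_coords[OF _ 1 assms(4) C]) (simp_all add: det2_def algebra_simps)
qed

lemma det3_point_bound:
  fixes \<xi> :: "real^2^'n"
  assumes C: "1 \<le> C" "\<And>j k. \<bar>\<xi> $ j $ k\<bar> \<le> C"
    and B: "\<And>f g h. f \<in> form_coords \<xi> \<Longrightarrow> g \<in> form_coords \<xi> \<Longrightarrow> h \<in> form_coords \<xi> \<Longrightarrow>
      \<bar>det3 f g h u v w\<bar> \<le> B"
    and "f \<in> point_coords" "g \<in> point_coords" "h \<in> point_coords"
  shows "\<bar>det3 f g h u v w\<bar> \<le> (3 * C) * ((3 * C) * ((3 * C) * B))"
proof -
  have 1: "\<bar>det3 f g h u v w\<bar> \<le> (3 * C) * B" if "f \<in> form_coords \<xi>" "g \<in> form_coords \<xi>" for f g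
    by (rule linear_bound_on_point_coords[OF _ B[OF that] assms(6) C])
      (simp_all add: det2_def det3_def algebra_simps)
  have 2: "\<bar>det3 f g h u v w\<bar> \<le> (3 * C) * ((3 * C) * B)" if "f \<in> form_coords \<xi>" for f
    by (rule linear_bound_on_point_coords[OF _ 1[OF that] assms(5) C])
      (simp_all add: det2_def det3_def algebra_simps)
  show ?thesis
    by (rule linear_bound_on_point_coords[OF _ 2 assms(4) C])
      (simp_all add: det2_def det3_def algebra_simps)
qed

lemma det4_point_bound:
  fixes \<xi> :: "real^2^'n"
  assumes C: "1 \<le> C" "\<And>j k. \<bar>\<xi> $ j $ k\<bar> \<le> C"
    and B: "\<And>f g h k. f \<in> form_coords \<xi> \<Longrightarrow> g \<in> form_coords \<xi> \<Longrightarrow> h \<in> form_coords \<xi> \<Longrightarrow>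
      k \<in> form_coords \<xi> \<Longrightarrow> \<bar>det4 f g h k u v w t\<bar> \<le> B"
    and "f \<in> point_coords" "g \<in> point_coords" "h \<in> point_coords" "k \<in> point_coords"
  shows "\<bar>det4 f g h k u v w t\<bar> \<le> (3 * C) * ((3 * C) * ((3 * C) * ((3 * C) * B)))"
proof -
  have 1: "\<bar>det4 f g h k u v w t\<bar> \<le> (3 * C) * B"
    if "f \<in> form_coords \<xi>" "g \<in> form_coords \<xi>" "h \<in> form_coords \<xi>" for f g h
    by (rule linear_bound_on_point_coords[OF _ B[OF that] assms(7) C])
      (simp_all add: det2_def det3_def det4_def algebra_simps)
  have 2: "\<bar>det4 f g h k u v w t\<bar> \<le> (3 * C) * ((3 * C) * B)"
    if "f \<in> form_coords \<xi>" "g \<in> form_coords \<xi>" for f g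
    by (rule linear_bound_on_point_coords[OF _ 1[OF that] assms(6) C])
      (simp_all add: det2_def det3_def det4_def algebra_simps)
  have 3: "\<bar>det4 f g h k u v w t\<bar> \<le> (3 * C) * ((3 * C) * ((3 * C) * B))"
    if "f \<in> form_coords \<xi>" for f
    by (rule linear_bound_on_point_coords[OF _ 2[OF that] assms(5) C])
      (simp_all add: det2_def det3_def det4_def algebra_simps)
  show ?thesis
    by (rule linear_bound_on_point_coords[OF _ 3 assms(4) C])
      (simp_all add: det2_def det3_def det4_def algebra_simps)
qed

section \<open>Upper bounds for minors by heights and errors\<close>

lemma form_coords_cases:
  assumes "g \<in> form_coords \<xi>"
  obtains "g = (\<lambda>p. fst p $ 1)" | "g = (\<lambda>p. fst p $ 2)" | "\<And>p. \<bar>g p\<bar> \<le> err \<xi> p"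
  using assms unfolding form_coords_def
proof (elim UnE rangeE)
  fix k :: 2 assume "g = (\<lambda>p. fst p $ k)"
  thus thesis using exhaust_2[of k] that by auto
next
  fix j assume "g = (\<lambda>p. (\<xi> *v fst p - snd p) $ j)"
  thus thesis by (intro that(3)) (simp only: err_def component_le_infnorm_cart)
qed

lemma form_coord_le:
  assumes "g \<in> form_coords \<xi>" "err \<xi> p \<le> ht p"
  shows "\<bar>g p\<bar> \<le> ht p"
  using assms(1)
proof (cases rule: form_coords_cases)
  case 3
  thus ?thesis using assms(2) order_trans by blast
qed (simp_all add: ht_def component_le_infnorm_cart)

lemma form_coord_lin:
  assumes "g \<in> form_coords \<xi>"
  shows "g (a *\<^sub>R u + b *\<^sub>R v) = a * g u + b * g v"
  using assms unfolding form_coords_def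
  by (auto simp: matrix_vector_right_distrib matrix_vector_mult_scaleR algebra_simps)

lemma ht_nonneg: "0 \<le> ht p" and err_nonneg: "0 \<le> err \<xi> p"
  by (simp_all add: ht_def err_def infnorm_pos_le)

lemma det2_form_bound:
  fixes \<xi> :: "real^2^'n"
  assumes "f \<in> form_coords \<xi>" "\<And>p. \<bar>g p\<bar> \<le> err \<xi> p"
    "ht u \<le> ht v" "err \<xi> v \<le> err \<xi> u" "err \<xi> u \<le> ht u"
  shows "\<bar>det2 f g u v\<bar> \<le> 2 * (err \<xi> u * ht v)"
proof -
  have f: "\<bar>f u\<bar> \<le> ht v" "\<bar>f v\<bar> \<le> ht v"
    using form_coord_le[OF assms(1), of u] form_coord_le[OF assms(1), of v] assms(3-5) by auto
  have g: "\<bar>g u\<bar> \<le> err \<xi> u" "\<bar>g v\<bar> \<le> err \<xi> u"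
    using assms(2)[of u] assms(2)[of v] assms(4) by auto
  have "\<bar>f u * g v\<bar> \<le> ht v * err \<xi> u" "\<bar>f v * g u\<bar> \<le> ht v * err \<xi> u"
    unfolding abs_mult using f g by (intro mult_mono; simp add: ht_nonneg err_nonneg)+
  thus ?thesis unfolding det2_def by (simp add: algebra_simps)
qed

text \<open>Only two forms may exceed the error, so three different rows contain a small one, and
  equal rows make the determinant 0. In each of the six products the small factor is at most the
  largest error \<open>err \<xi> u\<close>, and the others are at most the two largest
  heights.\<close>

lemma det3_form_bound:
  fixes \<xi> :: "real^2^'n"
  assumes in_form: "f \<in> form_coords \<xi>" "g \<in> form_coords \<xi>" "h \<in> form_coords \<xi>"
    and ord: "ht u \<le> ht v" "ht v \<le> ht w" "err \<xi> v \<le> err \<xi> u" "err \<xi> w \<le> err \<xi> v" "err \<xi> u \<le> ht u"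
  shows "\<bar>det3 f g h u v w\<bar> \<le> 6 * (err \<xi> u * ht v * ht w)"
proof -
  let ?B = "err \<xi> u * ht v * ht w"
  define small where "small = (\<lambda>g :: (real^2) \<times> (real^'n) \<Rightarrow> real. \<forall>p. \<bar>g p\<bar> \<le> err \<xi> p)"
  have err_le: "err \<xi> v \<le> ht v" "err \<xi> w \<le> ht w" using ord by simp_all
  have le: "\<bar>g u\<bar> \<le> ht v" "\<bar>g v\<bar> \<le> ht v" "\<bar>g v\<bar> \<le> ht w" "\<bar>g w\<bar> \<le> ht w"
    if "g \<in> form_coords \<xi>" for g
    using form_coord_le[OF that, of u] form_coord_le[OF that, of v] form_coord_le[OF that, of w]
      ord err_le by (blast intro: order_trans)+
  have sm: "\<bar>g u\<bar> \<le> err \<xi> u" "\<bar>g v\<bar> \<le> err \<xi> u" "\<bar>g w\<bar> \<le> err \<xi> u" if "small g" for g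
    using that ord unfolding small_def by (blast intro: order_trans)+
  have mult3: "a * b * c \<le> ?B"
    if "0 \<le> a" "0 \<le> b" "0 \<le> c" "a \<le> err \<xi> u" "b \<le> ht v" "c \<le> ht w" for a b c :: real
    using that by (intro mult_mono mult_nonneg_nonneg) (auto simp: ht_nonneg err_nonneg)
  have prod: "\<bar>f u * g v * h w\<bar> \<le> ?B"
    if "f \<in> form_coords \<xi>" "g \<in> form_coords \<xi>" "h \<in> form_coords \<xi>" "small f \<or> small g \<or> small h" for f g h
  proof -
    note l = le[OF that(1)] le[OF that(2)] le[OF that(3)] and sm_or = that(4)
    consider "small f" | "small g" | "small h" using sm_or by blast
    thus ?thesis
    proof cases
      case 1
      have "\<bar>f u\<bar> * \<bar>g v\<bar> * \<bar>h w\<bar> \<le> ?B"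
        by (intro mult3 abs_ge_zero l sm[OF 1])
      thus ?thesis by (simp add: abs_mult)
    next
      case 2
      have "\<bar>g v\<bar> * \<bar>f u\<bar> * \<bar>h w\<bar> \<le> ?B"
        by (intro mult3 abs_ge_zero l sm[OF 2])
      thus ?thesis by (simp add: abs_mult mult_ac)
    next
      case 3
      have "\<bar>h w\<bar> * \<bar>f u\<bar> * \<bar>g v\<bar> \<le> err \<xi> u * ht v * ht w"
        by (intro mult3 abs_ge_zero l sm[OF 3])
      thus ?thesis by (simp add: abs_mult mult_ac)
    qed
  qed
  have "\<exists>e1 e2. \<forall>g \<in> form_coords \<xi>. small g \<or> g = e1 \<or> g = e2"
  proof (intro exI ballI)
    fix g assume "g \<in> form_coords \<xi>"
    thus "small g \<or> g = (\<lambda>p. fst p $ 1) \<or> g = (\<lambda>p. fst p $ 2)"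
      by (cases rule: form_coords_cases) (unfold small_def, blast+)
  qed
  then obtain e1 e2 where e: "\<And>g. g \<in> form_coords \<xi> \<Longrightarrow> small g \<or> g = e1 \<or> g = e2"
    by blast
  have "small f \<or> small g \<or> small h \<or> f = g \<or> f = h \<or> g = h"
    using e[OF in_form(1)] e[OF in_form(2)] e[OF in_form(3)] by metis
  then consider "small f \<or> small g \<or> small h" | "f = g \<or> f = h \<or> g = h" by blast
  thus ?thesis
  proof cases
    case 1
    have "\<bar>det3 f g h u v w\<bar> \<le> \<bar>f u * g v * h w\<bar> + \<bar>f u * h v * g w\<bar> + \<bar>g u * f v * h w\<bar>
        + \<bar>h u * f v * g w\<bar> + \<bar>g u * h v * f w\<bar> + \<bar>h u * g v * f w\<bar>"
      unfolding det3_def det2_def by (simp add: algebra_simps)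
    also have "\<dots> \<le> ?B + ?B + ?B + ?B + ?B + ?B"
      using in_form 1 by (intro add_mono prod) auto
    finally show ?thesis by (simp add: mult_ac)
  next
    case 2
    hence "det3 f g h u v w = 0" by (auto simp: det3_def det2_def algebra_simps)
    thus ?thesis by (simp add: ht_nonneg err_nonneg)
  qed
qed

text \<open>Among four different rows at least two are small, so each of the 24 products has two
  factors bounded by the two largest errors and two bounded by the two largest heights.\<close>

lemma det4_form_bound:
  fixes \<xi> :: "real^2^'n"
  assumes in_form: "f \<in> form_coords \<xi>" "g \<in> form_coords \<xi>" "h \<in> form_coords \<xi>" "k \<in> form_coords \<xi>"
    and ord: "ht u \<le> ht v" "ht v \<le> ht w" "ht w \<le> ht t"
      "err \<xi> v \<le> err \<xi> u" "err \<xi> w \<le> err \<xi> v" "err \<xi> t \<le> err \<xi> w" "err \<xi> u \<le> ht u"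
  shows "\<bar>det4 f g h k u v w t\<bar> \<le> 24 * (err \<xi> u * err \<xi> v * ht w * ht t)"
proof -
  let ?B = "err \<xi> u * err \<xi> v * ht w * ht t"
  define small where "small = (\<lambda>g :: (real^2) \<times> (real^'n) \<Rightarrow> real. \<forall>p. \<bar>g p\<bar> \<le> err \<xi> p)"
  define two where "two = (\<lambda>f g h k. (small f \<and> (small g \<or> small h \<or> small k)) \<or>
     (small g \<and> (small h \<or> small k)) \<or> (small h \<and> small k))"
  have err_le: "err \<xi> v \<le> ht v" "err \<xi> w \<le> ht w" "err \<xi> t \<le> ht t" using ord by simp_all
  have le: "\<bar>g u\<bar> \<le> ht w" "\<bar>g u\<bar> \<le> ht t" "\<bar>g v\<bar> \<le> ht w" "\<bar>g v\<bar> \<le> ht t" "\<bar>g w\<bar> \<le> ht w"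
    "\<bar>g w\<bar> \<le> ht t" "\<bar>g t\<bar> \<le> ht t" if "g \<in> form_coords \<xi>" for g
    using form_coord_le[OF that, of u] form_coord_le[OF that, of v] form_coord_le[OF that, of w]
      form_coord_le[OF that, of t] ord err_le by (blast intro: order_trans)+
  have sm: "\<bar>g u\<bar> \<le> err \<xi> u" "\<bar>g v\<bar> \<le> err \<xi> u" "\<bar>g v\<bar> \<le> err \<xi> v" "\<bar>g w\<bar> \<le> err \<xi> u"
    "\<bar>g w\<bar> \<le> err \<xi> v" "\<bar>g t\<bar> \<le> err \<xi> v" if "small g" for g
    using that ord unfolding small_def by (blast intro: order_trans)+
  have mult4: "a * b * c * d \<le> ?B"
    if "0 \<le> a" "0 \<le> b" "0 \<le> c" "0 \<le> d" "a \<le> err \<xi> u" "b \<le> err \<xi> v" "c \<le> ht w" "d \<le> ht t"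
    for a b c d :: real
    using that by (intro mult_mono mult_nonneg_nonneg) (auto simp: ht_nonneg err_nonneg)
  have prod: "\<bar>f u * g v * h w * k t\<bar> \<le> ?B"
    if "f \<in> form_coords \<xi>" "g \<in> form_coords \<xi>" "h \<in> form_coords \<xi>" "k \<in> form_coords \<xi>" "two f g h k" for f g h k
  proof -
    note l = le[OF that(1)] le[OF that(2)] le[OF that(3)] le[OF that(4)] and tw = that(5)
    consider "small f" "small g" | "small f" "small h" | "small f" "small k" | "small g" "small h"
      | "small g" "small k" | "small h" "small k"
      using tw unfolding two_def by metis
    thus ?thesis
    proof cases
      case 1
      have "\<bar>f u\<bar> * \<bar>g v\<bar> * \<bar>h w\<bar> * \<bar>k t\<bar> \<le> ?B"
        by (intro mult4 abs_ge_zero l sm[OF 1(1)] sm[OF 1(2)])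
      thus ?thesis by (simp add: abs_mult mult_ac)
    next
      case 2
      have "\<bar>f u\<bar> * \<bar>h w\<bar> * \<bar>g v\<bar> * \<bar>k t\<bar> \<le> ?B"
        by (intro mult4 abs_ge_zero l sm[OF 2(1)] sm[OF 2(2)])
      thus ?thesis by (simp add: abs_mult mult_ac)
    next
      case 3
      have "\<bar>f u\<bar> * \<bar>k t\<bar> * \<bar>g v\<bar> * \<bar>h w\<bar> \<le> ?B"
        by (intro mult4 abs_ge_zero l sm[OF 3(1)] sm[OF 3(2)])
      thus ?thesis by (simp add: abs_mult mult_ac)
    next
      case 4
      have "\<bar>g v\<bar> * \<bar>h w\<bar> * \<bar>f u\<bar> * \<bar>k t\<bar> \<le> ?B"
        by (intro mult4 abs_ge_zero l sm[OF 4(1)] sm[OF 4(2)])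
      thus ?thesis by (simp add: abs_mult mult_ac)
    next
      case 5
      have "\<bar>g v\<bar> * \<bar>k t\<bar> * \<bar>f u\<bar> * \<bar>h w\<bar> \<le> ?B"
        by (intro mult4 abs_ge_zero l sm[OF 5(1)] sm[OF 5(2)])
      thus ?thesis by (simp add: abs_mult mult_ac)
    next
      case 6
      have "\<bar>h w\<bar> * \<bar>k t\<bar> * \<bar>f u\<bar> * \<bar>g v\<bar> \<le> ?B"
        by (intro mult4 abs_ge_zero l sm[OF 6(1)] sm[OF 6(2)])
      thus ?thesis by (simp add: abs_mult mult_ac)
    qed
  qed
  define P where "P = (\<lambda>f g h k :: (real^2) \<times> (real^'n) \<Rightarrow> real. f u * g v * h w * k t)"
  have P: "\<bar>P f g h k\<bar> \<le> ?B"
    if "f \<in> form_coords \<xi>" "g \<in> form_coords \<xi>" "h \<in> form_coords \<xi>" "k \<in> form_coords \<xi>" "two f g h k" for f g h k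
    unfolding P_def by (rule prod) fact+
  have "\<exists>e1 e2. \<forall>g \<in> form_coords \<xi>. small g \<or> g = e1 \<or> g = e2"
  proof (intro exI ballI)
    fix g assume "g \<in> form_coords \<xi>"
    thus "small g \<or> g = (\<lambda>p. fst p $ 1) \<or> g = (\<lambda>p. fst p $ 2)"
      by (cases rule: form_coords_cases) (unfold small_def, blast+)
  qed
  then obtain e1 e2 where e: "\<And>g. g \<in> form_coords \<xi> \<Longrightarrow> small g \<or> g = e1 \<or> g = e2"
    by blast
  have "two f g h k \<or> f = g \<or> f = h \<or> f = k \<or> g = h \<or> g = k \<or> h = k"
    using e[OF in_form(1)] e[OF in_form(2)] e[OF in_form(3)] e[OF in_form(4)]
    unfolding two_def by metis
  then consider "two f g h k" | "f = g \<or> f = h \<or> f = k \<or> g = h \<or> g = k \<or> h = k" by blast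
  thus ?thesis
  proof cases
    case 1
    have "det4 f g h k u v w t =
        P f g h k - P f g k h - P f h g k + P f h k g + P f k g h - P f k h g
      - (P g f h k - P g f k h - P h f g k + P h f k g + P k f g h - P k f h g)
      + (P g h f k - P g k f h - P h g f k + P h k f g + P k g f h - P k h f g)
      - (P g h k f - P g k h f - P h g k f + P h k g f + P k g h f - P k h g f)"
      unfolding det4_def det3_def det2_def P_def by (simp add: algebra_simps)
    \<comment> \<open>All 24 terms are the same product with permuted rows; the multiset of rows,
      and with it the number of small ones, is invariant under permutation.\<close>
    moreover have "\<bar>P f' g' h' k'\<bar> \<le> ?B" if "mset [f', g', h', k'] = mset [f, g, h, k]" for f' g' h' k'
    proof -
      have "set_mset (mset [f', g', h', k']) = set_mset (mset [f, g, h, k])" using that by simp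
      hence "{f', g', h', k'} = {f, g, h, k}" by simp
      hence "{f', g', h', k'} \<subseteq> form_coords \<xi>" using in_form by simp
      moreover have "2 \<le> size (filter_mset small (mset [f, g, h, k]))"
        using 1 unfolding two_def by auto
      hence "2 \<le> size (filter_mset small (mset [f', g', h', k']))" unfolding that .
      hence "two f' g' h' k'" unfolding two_def by (simp split: if_splits)
      ultimately show ?thesis by (intro P) auto
    qed
    hence "\<bar>P f g h k\<bar> \<le> ?B" "\<bar>P f g k h\<bar> \<le> ?B" "\<bar>P f h g k\<bar> \<le> ?B" "\<bar>P f h k g\<bar> \<le> ?B"
      "\<bar>P f k g h\<bar> \<le> ?B" "\<bar>P f k h g\<bar> \<le> ?B"
      "\<bar>P g f h k\<bar> \<le> ?B" "\<bar>P g f k h\<bar> \<le> ?B" "\<bar>P h f g k\<bar> \<le> ?B" "\<bar>P h f k g\<bar> \<le> ?B"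
      "\<bar>P k f g h\<bar> \<le> ?B" "\<bar>P k f h g\<bar> \<le> ?B"
      "\<bar>P g h f k\<bar> \<le> ?B" "\<bar>P g k f h\<bar> \<le> ?B" "\<bar>P h g f k\<bar> \<le> ?B" "\<bar>P h k f g\<bar> \<le> ?B"
      "\<bar>P k g f h\<bar> \<le> ?B" "\<bar>P k h f g\<bar> \<le> ?B"
      "\<bar>P g h k f\<bar> \<le> ?B" "\<bar>P g k h f\<bar> \<le> ?B" "\<bar>P h g k f\<bar> \<le> ?B" "\<bar>P h k g f\<bar> \<le> ?B"
      "\<bar>P k g h f\<bar> \<le> ?B" "\<bar>P k h g f\<bar> \<le> ?B"
      by simp_all
    ultimately show ?thesis unfolding abs_le_iff by linarith
  next
    case 2
    hence "det4 f g h k u v w t = 0"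
      by (elim disjE) (simp_all add: det4_def det3_def det2_def algebra_simps)
    thus ?thesis by (simp add: ht_nonneg err_nonneg)
  qed
qed

subsection \<open>Sequences of minimal points\<close>

lemma int_points_diff:
  assumes "p \<in> int_points" "q \<in> int_points"
  shows "p - of_int m *\<^sub>R q \<in> int_points"
proof -
  obtain x y x' y' where pq: "p = (rvec x, rvec y)" "q = (rvec x', rvec y')"
    using assms unfolding int_points_def by blast
  have "rvec x - of_int m *\<^sub>R rvec x' = rvec (\<chi> i. x $ i - m * x' $ i)"
    "rvec y - of_int m *\<^sub>R rvec y' = rvec (\<chi> i. y $ i - m * y' $ i)"
    by (simp_all add: rvec_def vec_eq_iff)
  thus ?thesis unfolding int_points_def by (auto simp: pq)
qed

lemma ht_comb: "ht (a *\<^sub>R p + b *\<^sub>R q) \<le> \<bar>a\<bar> * ht p + \<bar>b\<bar> * ht q"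
  unfolding ht_def using infnorm_triangle[of "a *\<^sub>R fst p" "b *\<^sub>R fst q"] by (simp add: infnorm_mul)

lemma err_comb: "err \<xi> (a *\<^sub>R p + b *\<^sub>R q) \<le> \<bar>a\<bar> * err \<xi> p + \<bar>b\<bar> * err \<xi> q"
proof -
  have "\<xi> *v fst (a *\<^sub>R p + b *\<^sub>R q) - snd (a *\<^sub>R p + b *\<^sub>R q)
      = a *\<^sub>R (\<xi> *v fst p - snd p) + b *\<^sub>R (\<xi> *v fst q - snd q)"
    by (simp add: algebra_simps)
  thus ?thesis
    unfolding err_def
    using infnorm_triangle[of "a *\<^sub>R (\<xi> *v fst p - snd p)" "b *\<^sub>R (\<xi> *v fst q - snd q)"]
    by (simp add: infnorm_mul)
qed

lemma ht_scaleR: "ht (a *\<^sub>R p) = \<bar>a\<bar> * ht p"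
  by (simp add: ht_def infnorm_mul)

lemma err_scaleR: "err \<xi> (a *\<^sub>R p) = \<bar>a\<bar> * err \<xi> p"
proof -
  have "\<xi> *v fst (a *\<^sub>R p) - snd (a *\<^sub>R p) = a *\<^sub>R (\<xi> *v fst p - snd p)"
    by (simp add: algebra_simps)
  thus ?thesis by (simp only: err_def infnorm_mul)
qed

lemma Ints_inverse_abs_1:
  fixes s :: real
  assumes "s \<in> \<int>" "1 / s \<in> \<int>" "s \<noteq> 0"
  shows "\<bar>s\<bar> = 1"
proof -
  have "1 \<le> \<bar>s\<bar>" using assms(1,3) by (rule Ints_nonzero_abs_ge1)
  moreover have "1 / s \<noteq> 0" using assms(3) by simp
  with assms(2) have "1 \<le> \<bar>1 / s\<bar>" by (rule Ints_nonzero_abs_ge1)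
  ultimately show ?thesis using assms(3) by (simp add: abs_divide field_simps)
qed

lemma graph_space_dim: "dim (graph_space \<xi>) = 2" and graph_space_subspace: "subspace (graph_space \<xi>)"
proof -
  have g: "graph_space \<xi> = (\<lambda>x. (x, \<xi> *v x)) ` UNIV"
    unfolding graph_space_def by auto
  have lin: "linear (\<lambda>x. (x, \<xi> *v x))"
    by (rule linearI) (simp_all add: algebra_simps)
  show "subspace (graph_space \<xi>)" unfolding g by (rule linear_subspace_image[OF lin]) simp
  have "dim ((\<lambda>x. (x, \<xi> *v x)) ` UNIV) = dim (UNIV :: (real^2) set)"
    by (rule dim_image_eq[OF lin]) (auto simp: inj_on_def)
  thus "dim (graph_space \<xi>) = 2" unfolding g by simp
qed

text \<open>What the argument uses about minimal points, detached from the step function.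
  \<open>minimal\<close> also ranges over nonzero points with first component 0; their error is at
  least 1, in accordance with \<open>err_le_1\<close>.\<close>

locale minimal_points =
  fixes \<xi> :: "real^2^'n" and z :: "nat \<Rightarrow> (real^2) \<times> (real^'n)"
  assumes int_pt: "z i \<in> int_points"
    and ht_0: "1 \<le> ht (z 0)"
    and ht_Suc: "ht (z i) < ht (z (Suc i))"
    and err_Suc: "err \<xi> (z (Suc i)) < err \<xi> (z i)"
    and err_pos: "0 < err \<xi> (z i)"
    and err_le_1: "err \<xi> (z i) \<le> 1"
    and minimal: "p \<in> int_points \<Longrightarrow> p \<noteq> 0 \<Longrightarrow> ht p < ht (z (Suc i)) \<Longrightarrow> err \<xi> (z i) \<le> err \<xi> p"
begin

abbreviation "X i \<equiv> ht (z i)"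
abbreviation "L i \<equiv> err \<xi> (z i)"

lemma X_mono: "i \<le> j \<Longrightarrow> X i \<le> X j"
  by (rule lift_Suc_mono_le[of X]) (use ht_Suc in \<open>auto intro: less_imp_le\<close>)

lemma L_antimono: "i \<le> j \<Longrightarrow> L j \<le> L i"
  by (rule lift_Suc_antimono_le[of L]) (use err_Suc in \<open>auto intro: less_imp_le\<close>)

lemma X_ge_1: "1 \<le> X i"
  using X_mono[of 0 i] ht_0 by simp

lemma L_le_X: "L i \<le> X i"
  using err_le_1[of i] X_ge_1[of i] by simp

lemma z_nonzero: "z i \<noteq> 0"
  using X_ge_1[of i] by (auto simp: ht_def infnorm_0)

lemma X_Ints: "X i \<in> \<int>"
  using int_pt[of i] unfolding int_points_def ht_def by (auto simp: infnorm_rvec_int)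

lemma X_ge: "real (Suc i) \<le> X i"
proof (induction i)
  case (Suc i)
  obtain a b where "X i = of_int a" "X (Suc i) = of_int b"
    using X_Ints[of i] X_Ints[of "Suc i"] by (auto elim!: Ints_cases)
  with ht_Suc[of i] Suc show ?case by simp
qed (use ht_0 in simp)

lemma X_at_top: "filterlim X at_top sequentially"
proof (rule filterlim_at_top_mono[OF filterlim_real_sequentially])
  show "\<forall>\<^sub>F i in sequentially. real i \<le> X i"
    using X_ge by (intro always_eventually allI) (meson less_imp_le of_nat_less_iff lessI order_trans)
qed

text \<open>A ratio would exceed 1 in absolute value because the heights grow, and be below 1
  because the errors shrink.\<close>

lemma not_parallel: "z (Suc i) \<notin> span {z i}"
proof
  assume "z (Suc i) \<in> span {z i}"
  then obtain r where r: "z (Suc i) = r *\<^sub>R z i" by (auto simp: span_singleton)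
  have "1 * X i < \<bar>r\<bar> * X i" using ht_Suc[of i] by (simp add: r ht_scaleR)
  hence "1 < \<bar>r\<bar>" using X_ge_1[of i] by (subst (asm) mult_less_cancel_right) auto
  moreover have "\<bar>r\<bar> * L i < 1 * L i" using err_Suc[of i] by (simp add: r err_scaleR)
  hence "\<bar>r\<bar> < 1" using err_pos[of i] by (subst (asm) mult_less_cancel_right) auto
  ultimately show False by simp
qed

lemma not_parallel': "z i \<notin> span {z (Suc i)}"
proof
  assume "z i \<in> span {z (Suc i)}"
  then obtain r where r: "z i = r *\<^sub>R z (Suc i)" by (auto simp: span_singleton)
  hence "r \<noteq> 0" using z_nonzero[of i] by auto
  hence "z (Suc i) = (1 / r) *\<^sub>R z i" by (simp add: r)
  hence "z (Suc i) \<in> span {z i}" by (metis insertI1 span_base span_scale)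
  thus False using not_parallel by simp
qed

text \<open>Consecutive minimal points form a basis of the integer points in their plane.
  Subtracting the rounded coefficients leaves an integer point with coefficients at most 1/2; its
  height is below \<open>X (Suc i)\<close> and its error below \<open>L i\<close>, so by minimality
  it is 0.\<close>

lemma integral_coefficients:
  assumes "s *\<^sub>R z i + t *\<^sub>R z (Suc i) \<in> int_points"
  shows "s \<in> \<int>" "t \<in> \<int>"
proof -
  define s' where "s' = s - of_int (round s)"
  define t' where "t' = t - of_int (round t)"
  have st': "\<bar>s'\<bar> \<le> 1 / 2" "\<bar>t'\<bar> \<le> 1 / 2"
    unfolding s'_def t'_def using of_int_round_abs_le[of s] of_int_round_abs_le[of t]
    by (simp_all add: abs_minus_commute)
  define p where "p = s' *\<^sub>R z i + t' *\<^sub>R z (Suc i)"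
  have "p = (s *\<^sub>R z i + t *\<^sub>R z (Suc i) - of_int (round s) *\<^sub>R z i) - of_int (round t) *\<^sub>R z (Suc i)"
    by (simp add: p_def s'_def t'_def algebra_simps)
  hence p_int: "p \<in> int_points" using assms int_pt by (simp add: int_points_diff)
  have "ht p \<le> \<bar>s'\<bar> * X i + \<bar>t'\<bar> * X (Suc i)" unfolding p_def by (rule ht_comb)
  also have "\<dots> \<le> 1 / 2 * X i + 1 / 2 * X (Suc i)"
    using st' by (intro add_mono mult_right_mono) (auto simp: ht_nonneg)
  also have "\<dots> < X (Suc i)" using ht_Suc[of i] by simp
  finally have ht_p: "ht p < X (Suc i)" .
  have "err \<xi> p \<le> \<bar>s'\<bar> * L i + \<bar>t'\<bar> * L (Suc i)" unfolding p_def by (rule err_comb)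
  also have "\<dots> \<le> 1 / 2 * L i + 1 / 2 * L (Suc i)"
    using st' by (intro add_mono mult_right_mono) (auto simp: err_nonneg)
  also have "\<dots> < L i" using err_Suc[of i] by simp
  finally have "p = 0" using minimal[OF p_int _ ht_p] by force
  have "t' = 0"
  proof (rule ccontr)
    assume "t' \<noteq> 0"
    have "z (Suc i) = (- s' / t') *\<^sub>R z i"
    proof -
      have "t' *\<^sub>R z (Suc i) = - (s' *\<^sub>R z i)"
        using \<open>p = 0\<close> unfolding p_def by (simp add: add_eq_0_iff)
      hence "(1 / t') *\<^sub>R t' *\<^sub>R z (Suc i) = (1 / t') *\<^sub>R (- (s' *\<^sub>R z i))" by simp
      thus ?thesis using \<open>t' \<noteq> 0\<close> by simp
    qed
    hence "z (Suc i) \<in> span {z i}" by (metis insertI1 span_base span_scale)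
    thus False using not_parallel by simp
  qed
  moreover from this have "s' = 0" using \<open>p = 0\<close> z_nonzero[of i] by (simp add: p_def)
  ultimately have "s = of_int (round s)" "t = of_int (round t)" by (simp_all add: s'_def t'_def)
  thus "s \<in> \<int>" "t \<in> \<int>" by (metis Ints_of_int)+
qed

text \<open>The pairs at \<open>i\<close> and \<open>Suc i\<close> are bases of the same planar
  lattice, so the change of basis has determinant 1 or -1.\<close>

lemma det2_planar_step:
  assumes "z (Suc (Suc i)) \<in> span {z i, z (Suc i)}" "f \<in> form_coords \<xi>" "g \<in> form_coords \<xi>"
  shows "\<bar>det2 f g (z (Suc i)) (z (Suc (Suc i)))\<bar> = \<bar>det2 f g (z i) (z (Suc i))\<bar>"
proof -
  obtain s where "z (Suc (Suc i)) - s *\<^sub>R z i \<in> span {z (Suc i)}"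
    using assms(1) by (auto simp: span_insert)
  then obtain t where "z (Suc (Suc i)) - s *\<^sub>R z i = t *\<^sub>R z (Suc i)"
    by (auto simp: span_singleton)
  hence st: "z (Suc (Suc i)) = s *\<^sub>R z i + t *\<^sub>R z (Suc i)" by (simp add: algebra_simps)
  have "s \<noteq> 0"
  proof
    assume "s = 0"
    hence "z (Suc (Suc i)) \<in> span {z (Suc i)}" unfolding st by (simp add: span_base span_scale)
    thus False using not_parallel by simp
  qed
  have "s \<in> \<int>" using integral_coefficients(1)[of s i t] int_pt st by metis
  have "(1 / s) *\<^sub>R z (Suc (Suc i)) = z i + (t / s) *\<^sub>R z (Suc i)"
    unfolding st using \<open>s \<noteq> 0\<close> by (simp add: scaleR_add_right)
  \<comment> \<open>Solved for \<open>z i\<close>, the relation has coefficient \<open>1 / s\<close>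
    at \<open>z (Suc (Suc i))\<close>, which is integral because the later pair is a basis
    too.\<close>
  hence "(- t / s) *\<^sub>R z (Suc i) + (1 / s) *\<^sub>R z (Suc (Suc i)) = z i" by simp
  hence "1 / s \<in> \<int>" using integral_coefficients(2) int_pt by metis
  have "\<bar>s\<bar> = 1" using Ints_inverse_abs_1 \<open>s \<in> \<int>\<close> \<open>1 / s \<in> \<int>\<close> \<open>s \<noteq> 0\<close> .
  have "det2 f g (z (Suc i)) (z (Suc (Suc i))) = - s * det2 f g (z i) (z (Suc i))"
    unfolding st det2_def form_coord_lin[OF assms(2)] form_coord_lin[OF assms(3)]
    by (simp add: algebra_simps)
  thus ?thesis using \<open>\<bar>s\<bar> = 1\<close> by (simp add: abs_mult)
qed

text \<open>If all these minors were small, the two points would nearly agree up to sign, and their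
  sum or difference would violate minimality.\<close>

lemma large_mixed_minor:
  obtains f g where "f \<in> form_coords \<xi>" "g \<in> form_coords \<xi>" "\<forall>p. \<bar>g p\<bar> \<le> err \<xi> p"
    "X (Suc i) * L i \<le> 4 * \<bar>det2 f g (z i) (z (Suc i))\<bar>"
proof (rule ccontr)
  assume contra: "\<not> thesis"
  define x where "x = fst (z i)"
  define x' where "x' = fst (z (Suc i))"
  define s where "s = \<xi> *v fst (z i) - snd (z i)"
  define s' where "s' = \<xi> *v fst (z (Suc i)) - snd (z (Suc i))"
  have minor: "4 * \<bar>x $ k * s' $ a - x' $ k * s $ a\<bar> < X (Suc i) * L i" for k a
  proof (rule ccontr)
    assume *: "\<not> ?thesis"
    have "(\<lambda>p. fst p $ k) \<in> form_coords \<xi>" "(\<lambda>p. (\<xi> *v fst p - snd p) $ a) \<in> form_coords \<xi>"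
      unfolding form_coords_def by blast+
    moreover have "\<forall>p. \<bar>(\<xi> *v fst p - snd p) $ a\<bar> \<le> err \<xi> p"
      unfolding err_def by (intro allI component_le_infnorm_cart)
    moreover have "X (Suc i) * L i
        \<le> 4 * \<bar>det2 (\<lambda>p. fst p $ k) (\<lambda>p. (\<xi> *v fst p - snd p) $ a) (z i) (z (Suc i))\<bar>"
      using * unfolding det2_def x_def x'_def s_def s'_def by (rule linorder_not_less[THEN iffD1])
    ultimately have thesis by (rule that)
    thus False using contra by simp
  qed
  have X: "X i = infnorm x" "X (Suc i) = infnorm x'" and L: "L i = infnorm s" "L (Suc i) = infnorm s'"
    by (simp_all add: ht_def err_def x_def x'_def s_def s'_def)
  \<comment> \<open>The larger height is attained at \<open>k\<close> and the larger error at
    \<open>a\<close>; division by these entries turns small minors into close vectors.\<close>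
  obtain k where k: "X (Suc i) = \<bar>x' $ k\<bar>" using infnorm_attained[of x'] X(2) by metis
  obtain a where a: "L i = \<bar>s $ a\<bar>" using infnorm_attained[of s] L(1) by metis
  have nz: "x' $ k \<noteq> 0" "s $ a \<noteq> 0" using X_ge_1[of "Suc i"] err_pos[of i] k a by auto
  define \<tau> where "\<tau> = x $ k / x' $ k"
  define \<rho> where "\<rho> = s' $ a / s $ a"
  have xk: "x $ k = \<tau> * x' $ k" and sa: "s' $ a = \<rho> * s $ a"
    using nz by (simp_all add: \<tau>_def \<rho>_def)
  have "\<bar>x $ k\<bar> \<le> \<bar>x' $ k\<bar>"
    using component_le_infnorm_cart[of x k] X ht_Suc[of i] k by linarith
  hence \<tau>: "\<bar>\<tau>\<bar> \<le> 1" using nz by (simp add: \<tau>_def abs_divide divide_le_eq_1)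
  have "\<bar>s' $ a\<bar> \<le> \<bar>s $ a\<bar>"
    using component_le_infnorm_cart[of s' a] L err_Suc[of i] a by linarith
  hence \<rho>: "\<bar>\<rho>\<bar> \<le> 1" using nz by (simp add: \<rho>_def abs_divide divide_le_eq_1)
  \<comment> \<open>The minors with row \<open>k\<close>, divided by \<open>x' $ k\<close>, put
    \<open>s\<close> close to \<open>\<tau>\<close> times \<open>s'\<close>; next, those with row
    \<open>a\<close>, divided by \<open>s $ a\<close>, put \<open>x'\<close> close to
    \<open>\<rho>\<close> times \<open>x\<close>.\<close>
  have s_close: "4 * \<bar>\<tau> * s' $ b - s $ b\<bar> < L i" for b
  proof -
    have "4 * \<bar>x' $ k * (\<tau> * s' $ b - s $ b)\<bar> < \<bar>x' $ k\<bar> * L i"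
      using minor[of k b] by (simp add: xk k algebra_simps)
    hence "\<bar>x' $ k\<bar> * (4 * \<bar>\<tau> * s' $ b - s $ b\<bar>) < \<bar>x' $ k\<bar> * L i"
      unfolding abs_mult by (simp add: algebra_simps)
    thus ?thesis using nz by simp
  qed
  have x_close: "4 * \<bar>\<rho> * x $ l - x' $ l\<bar> < X (Suc i)" for l
  proof -
    have "4 * \<bar>s $ a * (\<rho> * x $ l - x' $ l)\<bar> < X (Suc i) * \<bar>s $ a\<bar>"
      using minor[of l a] by (simp add: sa a algebra_simps)
    hence "\<bar>s $ a\<bar> * (4 * \<bar>\<rho> * x $ l - x' $ l\<bar>) < \<bar>s $ a\<bar> * X (Suc i)"
      unfolding abs_mult by (simp add: algebra_simps)
    thus ?thesis using nz by simp
  qed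
  \<comment> \<open>At \<open>l = k\<close>, \<open>x_close\<close> says that
    \<open>\<rho> * \<tau>\<close> is close to 1. Both factors are at most 1 in absolute value, so
    they share a sign \<open>\<sigma>\<close> and lie within 1/4 of it.\<close>
  have "\<bar>x' $ k\<bar> * (4 * \<bar>\<rho> * \<tau> - 1\<bar>) < \<bar>x' $ k\<bar> * 1"
  proof -
    have "\<rho> * x $ k - x' $ k = x' $ k * (\<rho> * \<tau> - 1)" by (simp add: xk algebra_simps)
    thus ?thesis using x_close[of k] by (simp add: k abs_mult)
  qed
  hence "4 * \<bar>\<rho> * \<tau> - 1\<bar> < 1" using nz by (subst (asm) mult_less_cancel_left) auto
  hence \<rho>\<tau>: "3 / 4 < \<rho> * \<tau>" unfolding abs_if by (simp split: if_splits)
  have "\<bar>\<rho>\<bar> * \<bar>\<tau>\<bar> \<le> \<bar>\<rho>\<bar> * 1" "\<bar>\<rho>\<bar> * \<bar>\<tau>\<bar> \<le> 1 * \<bar>\<tau>\<bar>"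
    using \<tau> \<rho> by (intro mult_mono; simp)+
  hence big: "3 / 4 < \<bar>\<rho>\<bar>" "3 / 4 < \<bar>\<tau>\<bar>" using \<rho>\<tau> by (simp_all add: abs_mult[symmetric])
  obtain \<sigma> :: int where \<sigma>: "\<sigma> = 1 \<or> \<sigma> = -1" "\<bar>\<tau> - \<sigma>\<bar> \<le> 1 / 4" "\<bar>\<rho> - \<sigma>\<bar> \<le> 1 / 4"
  proof (cases "0 \<le> \<tau>")
    case True
    have "0 \<le> \<rho>"
    proof (rule ccontr)
      assume "\<not> 0 \<le> \<rho>"
      hence "\<rho> * \<tau> \<le> 0" using True by (simp add: mult_nonpos_nonneg)
      thus False using \<rho>\<tau> by simp
    qed
    thus thesis using True big \<tau> \<rho> by (intro that[of 1]) auto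
  next
    case False
    have "\<rho> \<le> 0"
    proof (rule ccontr)
      assume "\<not> \<rho> \<le> 0"
      hence "\<rho> * \<tau> \<le> 0" using False by (simp add: mult_nonneg_nonpos)
      thus False using \<rho>\<tau> by simp
    qed
    thus thesis using False big \<tau> \<rho> by (intro that[of "-1"]) auto
  qed
  \<comment> \<open>Replacing the ratios by \<open>\<sigma>\<close> adds a discrepancy of at most a
    quarter to one of less than a quarter, so \<open>p\<close> has height below
    \<open>X (Suc i)\<close> and error below \<open>L i\<close>.\<close>
  define p where "p = z i - of_int \<sigma> *\<^sub>R z (Suc i)"
  have p_int: "p \<in> int_points" unfolding p_def using int_pt by (intro int_points_diff)
  have "p \<noteq> 0"
  proof
    assume "p = 0"
    hence "z i = of_int \<sigma> *\<^sub>R z (Suc i)" by (simp add: p_def)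
    hence "z i \<in> span {z (Suc i)}" by (metis insertI1 span_base span_scale)
    thus False using not_parallel' by simp
  qed
  have close: "\<bar>B - C\<bar> < Y" if "4 * \<bar>A - B\<bar> \<le> Y" "4 * \<bar>A - C\<bar> < Y" for A B C Y :: real
    using that by (simp add: abs_if split: if_splits)
  have "ht p < X (Suc i)" unfolding ht_def infnorm_less_iff
  proof
    fix l
    have "\<bar>\<rho> - \<sigma>\<bar> * \<bar>x $ l\<bar> \<le> 1 / 4 * X (Suc i)"
      using \<sigma>(3) component_le_infnorm_cart[of x l] X ht_Suc[of i] by (intro mult_mono) auto
    hence "4 * \<bar>\<rho> * x $ l - \<sigma> * x $ l\<bar> \<le> X (Suc i)"
      unfolding abs_mult[symmetric] by (simp add: algebra_simps)
    hence "\<bar>\<sigma> * x $ l - x' $ l\<bar> < X (Suc i)" using x_close[of l] by (rule close)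
    moreover have "\<bar>fst p $ l\<bar> = \<bar>\<sigma> * x $ l - x' $ l\<bar>"
      using \<sigma>(1) by (auto simp: p_def x_def x'_def)
    ultimately show "\<bar>fst p $ l\<bar> < infnorm (fst (z (Suc i)))" using X by (simp add: x'_def)
  qed
  hence "L i \<le> err \<xi> p" using minimal p_int \<open>p \<noteq> 0\<close> by blast
  moreover have "err \<xi> p < L i" unfolding err_def infnorm_less_iff
  proof
    fix b
    have "\<bar>\<tau> - \<sigma>\<bar> * \<bar>s' $ b\<bar> \<le> 1 / 4 * L i"
      using \<sigma>(2) component_le_infnorm_cart[of s' b] L err_Suc[of i] by (intro mult_mono) auto
    hence "4 * \<bar>\<tau> * s' $ b - \<sigma> * s' $ b\<bar> \<le> L i"
      unfolding abs_mult[symmetric] by (simp add: algebra_simps)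
    hence "\<bar>\<sigma> * s' $ b - s $ b\<bar> < L i" using s_close[of b] by (rule close)
    hence "\<bar>s $ b - \<sigma> * s' $ b\<bar> < L i" by (simp add: abs_minus_commute)
    moreover have "(\<xi> *v fst p - snd p) $ b = s $ b - \<sigma> * s' $ b"
      by (simp add: p_def s_def s'_def algebra_simps)
    ultimately show "\<bar>(\<xi> *v fst p - snd p) $ b\<bar> < infnorm (\<xi> *v fst (z i) - snd (z i))"
      using L by (simp add: s_def)
  qed
  ultimately show False by simp
qed

text \<open>The mixed minor that is large at \<open>i\<close> keeps its absolute value along the
  run. The factor 8 is 4 from the lower bound at \<open>i\<close> times 2 from the upper bound at
  \<open>j\<close>.\<close>

lemma planar_run_comparison:
  assumes "i \<le> j" "\<And>l. i \<le> l \<Longrightarrow> l < j \<Longrightarrow> z (Suc (Suc l)) \<in> span {z l, z (Suc l)}"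
  shows "X (Suc i) * L i \<le> 8 * (X (Suc j) * L j)"
proof -
  obtain f g where fg: "f \<in> form_coords \<xi>" "g \<in> form_coords \<xi>" "\<forall>p. \<bar>g p\<bar> \<le> err \<xi> p"
    "X (Suc i) * L i \<le> 4 * \<bar>det2 f g (z i) (z (Suc i))\<bar>"
    by (rule large_mixed_minor[of i])
  have "\<bar>det2 f g (z j) (z (Suc j))\<bar> = \<bar>det2 f g (z i) (z (Suc i))\<bar>"
    using assms
  proof (induction j rule: dec_induct)
    case (step j)
    thus ?case using det2_planar_step[of j f g] fg by simp
  qed simp
  moreover have "\<bar>det2 f g (z j) (z (Suc j))\<bar> \<le> 2 * (L j * X (Suc j))"
    using fg(1) ht_Suc[of j] err_Suc[of j] L_le_X[of j]
    by (intro det2_form_bound fg(3)[rule_format]) auto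
  ultimately show ?thesis using fg(4) by (simp add: mult_ac)
qed

end

text \<open>A negative power of \<open>Y\<close> tends to 0. \<open>P\<close> is only known from
  some index on; as a premise under the existential it may be used once the index has been
  chosen.\<close>

lemma frequently_ge_1_absurd:
  fixes Y :: "nat \<Rightarrow> real"
  assumes "filterlim Y at_top sequentially" "s < 0" "\<forall>\<^sub>F i in sequentially. P i"
    and "\<And>N. \<exists>i\<ge>N. P i \<longrightarrow> 1 \<le> M * Y i powr s"
  shows False
proof -
  have "(\<lambda>i. M * Y i powr s) \<longlonglongrightarrow> M * 0"
    by (intro tendsto_mult tendsto_const tendsto_neg_powr assms)
  hence "\<forall>\<^sub>F i in sequentially. M * Y i powr s < 1" by (intro order_tendstoD) auto
  with assms(3) have "\<forall>\<^sub>F i in sequentially. P i \<and> M * Y i powr s < 1" by (rule eventually_conj)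
  then obtain N where "\<And>i. i \<ge> N \<Longrightarrow> P i \<and> M * Y i powr s < 1"
    unfolding eventually_sequentially by blast
  thus False using assms(4)[of N] by force
qed

section \<open>Subspaces containing all late minimal points\<close>

context minimal_points
begin

text \<open>A functional vanishing on \<open>S\<close> has size \<open>O(L l)\<close> at the graph point above \<open>z l\<close>. If it did not
  vanish on the graph, then all minors of order 2 of \<open>z l\<close> and \<open>z (Suc l)\<close> would tend to 0.\<close>

lemma graph_subset_of_eventual_subspace:
  assumes S: "subspace S" "\<And>l. N \<le> l \<Longrightarrow> z l \<in> S"
    and lim: "(\<lambda>l. X (Suc l) * L l) \<longlonglongrightarrow> 0"
  shows "graph_space \<xi> \<subseteq> S"
proof
  fix v assume "v \<in> graph_space \<xi>"
  then obtain x where v: "v = (x, \<xi> *v x)" unfolding graph_space_def by auto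
  \<comment> \<open>The functional is the inner product with the component \<open>q\<close> of
    \<open>v\<close> orthogonal to \<open>S\<close>; once it annihilates \<open>v\<close>,
    \<open>q\<close> is 0.\<close>
  obtain y q where yq: "y \<in> span S" "\<And>w. w \<in> span S \<Longrightarrow> orthogonal q w" "v = y + q"
    using orthogonal_subspace_decomp_exists[of S v] by metis
  \<comment> \<open>Coefficients of the functional pulled back to the plane along the graph.\<close>
  define \<theta> where "\<theta> = (\<lambda>k. q \<bullet> (axis k 1, \<xi> *v axis k 1))"
  have \<theta>: "q \<bullet> (w, \<xi> *v w) = \<theta> 1 * w $ 1 + \<theta> 2 * w $ 2" for w
  proof -
    have w: "w = w $ 1 *\<^sub>R axis 1 1 + w $ 2 *\<^sub>R axis 2 1"
      by (simp add: vec_eq_iff forall_2 axis_def)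
    have "(w, \<xi> *v w) = w $ 1 *\<^sub>R (axis 1 1, \<xi> *v axis 1 1) + w $ 2 *\<^sub>R (axis 2 1, \<xi> *v axis 2 1)"
      by (subst (1 2) w) (simp add: algebra_simps)
    thus ?thesis unfolding \<theta>_def by (simp only: inner_add_right inner_scaleR_right mult.commute)
  qed
  have "\<theta> 1 = 0 \<and> \<theta> 2 = 0"
  proof (rule ccontr)
    assume "\<not> ?thesis"
    then obtain t where t: "t \<noteq> 0" "t = \<theta> 1 \<or> t = \<theta> 2" by blast
    define C1 where "C1 = norm (snd q) * sqrt DIM(real^'n)"
    have C1: "0 \<le> C1" by (simp add: C1_def)
    have small: "\<bar>\<theta> 1 * fst (z l) $ 1 + \<theta> 2 * fst (z l) $ 2\<bar> \<le> C1 * L l" if "N \<le> l" for l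
    proof -
      let ?s = "\<xi> *v fst (z l) - snd (z l)"
      have "z l \<in> span S" using S(2)[OF that] by (rule span_base)
      hence "q \<bullet> z l = 0" using yq(2) by (simp add: orthogonal_def)
      hence "\<theta> 1 * fst (z l) $ 1 + \<theta> 2 * fst (z l) $ 2 = snd q \<bullet> ?s"
        unfolding \<theta>[symmetric] by (simp add: inner_diff_right inner_prod_def)
      also have "\<bar>\<dots>\<bar> \<le> norm (snd q) * norm ?s" by (rule Cauchy_Schwarz_ineq2)
      also have "\<dots> \<le> norm (snd q) * (sqrt DIM(real^'n) * infnorm ?s)"
        by (intro mult_left_mono norm_le_infnorm) simp
      finally show ?thesis by (simp add: C1_def err_def mult_ac)
    qed
    \<comment> \<open>Multiplying by the nonzero coefficient \<open>t\<close> amounts to replacing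
      one row of the minor by the small functional, since multiples of the other row cancel.\<close>
    have det_x: "\<bar>t\<bar> * \<bar>det2 (\<lambda>p. fst p $ 1) (\<lambda>p. fst p $ 2) (z l) (z (Suc l))\<bar>
        \<le> 2 * C1 * (X (Suc l) * L l)" if "N \<le> l" for l
    proof -
      let ?x = "fst (z l)" and ?x' = "fst (z (Suc l))"
      let ?h = "\<theta> 1 * ?x $ 1 + \<theta> 2 * ?x $ 2" and ?h' = "\<theta> 1 * ?x' $ 1 + \<theta> 2 * ?x' $ 2"
      have h: "\<bar>?h\<bar> \<le> C1 * L l" using small[OF that] .
      have "\<bar>?h'\<bar> \<le> C1 * L (Suc l)" using small[of "Suc l"] that by simp
      also have "\<dots> \<le> C1 * L l" using C1 err_Suc[of l] by (intro mult_left_mono) auto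
      finally have h': "\<bar>?h'\<bar> \<le> C1 * L l" .
      have x: "\<bar>?x $ k\<bar> \<le> X (Suc l)" for k
        using component_le_infnorm_cart[of ?x k] ht_Suc[of l] unfolding ht_def by linarith
      have x': "\<bar>?x' $ k\<bar> \<le> X (Suc l)" for k
        using component_le_infnorm_cart[of ?x' k] unfolding ht_def .
      have le: "\<bar>a * d - b * e\<bar> \<le> 2 * C1 * (X (Suc l) * L l)"
        if "\<bar>a\<bar> \<le> C1 * L l" "\<bar>b\<bar> \<le> C1 * L l" "\<bar>d\<bar> \<le> X (Suc l)" "\<bar>e\<bar> \<le> X (Suc l)" for a b d e
      proof -
        have "\<bar>a\<bar> * \<bar>d\<bar> \<le> C1 * L l * X (Suc l)" "\<bar>b\<bar> * \<bar>e\<bar> \<le> C1 * L l * X (Suc l)"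
          using that C1 by (intro mult_mono; simp add: err_nonneg)+
        thus ?thesis
          using abs_triangle_ineq4[of "a * d" "b * e"] by (simp add: abs_mult mult_ac)
      qed
      from t(2) show ?thesis
      proof
        assume "t = \<theta> 1"
        hence "t * det2 (\<lambda>p. fst p $ 1) (\<lambda>p. fst p $ 2) (z l) (z (Suc l)) = ?h * ?x' $ 2 - ?h' * ?x $ 2"
          by (simp add: det2_def algebra_simps)
        thus ?thesis unfolding abs_mult[symmetric] using le[OF h h' x' x] by simp
      next
        assume "t = \<theta> 2"
        hence "t * det2 (\<lambda>p. fst p $ 1) (\<lambda>p. fst p $ 2) (z l) (z (Suc l)) = ?h' * ?x $ 1 - ?h * ?x' $ 1"
          by (simp add: det2_def algebra_simps)
        thus ?thesis unfolding abs_mult[symmetric] using le[OF h' h x x'] by simp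
      qed
    qed
    \<comment> \<open>The 2 serves minors that contain a small form, the other summand the minor of
      the two coordinates of x.\<close>
    define K where "K = 2 + 2 * C1 / \<bar>t\<bar>"
    have form: "\<bar>det2 f g (z l) (z (Suc l))\<bar> \<le> K * (X (Suc l) * L l)"
      if "N \<le> l" "f \<in> form_coords \<xi>" "g \<in> form_coords \<xi>" for f g l
    proof -
      have nn: "0 \<le> X (Suc l) * L l" by (simp add: ht_nonneg err_nonneg)
      have "2 \<le> K" unfolding K_def using C1 by simp
      hence two: "2 * (X (Suc l) * L l) \<le> K * (X (Suc l) * L l)" using nn by (rule mult_right_mono)
      have "\<bar>det2 (\<lambda>p. fst p $ 1) (\<lambda>p. fst p $ 2) (z l) (z (Suc l))\<bar>
          \<le> 2 * C1 / \<bar>t\<bar> * (X (Suc l) * L l)"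
        using det_x[OF that(1)] t(1) by (simp add: field_simps)
      also have "\<dots> \<le> K * (X (Suc l) * L l)" using nn by (intro mult_right_mono) (simp_all add: K_def)
      finally have xx: "\<bar>det2 (\<lambda>p. fst p $ 1) (\<lambda>p. fst p $ 2) (z l) (z (Suc l))\<bar>
          \<le> K * (X (Suc l) * L l)" .
      have swap: "\<bar>det2 f g u v\<bar> = \<bar>det2 g f u v\<bar>" for f g :: "(real^2) \<times> (real^'n) \<Rightarrow> real" and u v
        by (simp add: det2_def abs_minus_commute mult.commute)
      have mixed: "\<bar>det2 f g (z l) (z (Suc l))\<bar> \<le> K * (X (Suc l) * L l)"
        if "f \<in> form_coords \<xi>" "\<And>p. \<bar>g p\<bar> \<le> err \<xi> p" for f g
        using det2_form_bound[OF that, of "z l" "z (Suc l)"] ht_Suc[of l] err_Suc[of l] L_le_X[of l] two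
        by (simp add: mult.commute)
      from that(3) show ?thesis
      proof (cases rule: form_coords_cases)
        case 3
        thus ?thesis using that(2) by (intro mixed)
      next
        case 1
        from that(2) show ?thesis
        proof (cases rule: form_coords_cases)
          case 3
          thus ?thesis using that(3) swap[of f g] by (metis mixed)
        next
          case 2
          thus ?thesis using 1 xx swap[of f g] by simp
        next
          case f1: 1
          have "det2 f g (z l) (z (Suc l)) = 0" using f1 1 by (simp add: det2_def)
          thus ?thesis using nn \<open>2 \<le> K\<close> by simp
        qed
      next
        case 2
        from that(2) show ?thesis
        proof (cases rule: form_coords_cases)
          case 3
          thus ?thesis using that(3) swap[of f g] by (metis mixed)
        next
          case 1
          thus ?thesis using 2 xx by simp
        next
          case f2: 2
          have "det2 f g (z l) (z (Suc l)) = 0" using f2 2 by (simp add: det2_def)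
          thus ?thesis using nn \<open>2 \<le> K\<close> by simp
        qed
      qed
    qed
    obtain C where C: "1 \<le> C" "\<And>j k. \<bar>\<xi> $ j $ k\<bar> \<le> C" using matrix_entries_bounded by metis
    have "(\<lambda>l. (3 * C) * ((3 * C) * (K * (X (Suc l) * L l)))) \<longlonglongrightarrow> (3 * C) * ((3 * C) * (K * 0))"
      by (intro tendsto_mult tendsto_const lim)
    hence "\<forall>\<^sub>F l in sequentially. (3 * C) * ((3 * C) * (K * (X (Suc l) * L l))) < 1"
      by (rule order_tendstoD(2)) simp
    then obtain M where M: "\<And>l. M \<le> l \<Longrightarrow> (3 * C) * ((3 * C) * (K * (X (Suc l) * L l))) < 1"
      unfolding eventually_sequentially by blast
    define l where "l = max M N"
    \<comment> \<open>Consecutive points are not parallel, so some minor is a nonzero integer, yet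
      by the choice of \<open>l\<close> it is below 1.\<close>
    obtain f g where fg: "f \<in> point_coords" "g \<in> point_coords" "det2 f g (z l) (z (Suc l)) \<noteq> 0"
      using det2_nonzero[OF z_nonzero not_parallel, of l] by metis
    have "det2 f g (z l) (z (Suc l)) \<in> \<int>"
      using fg int_pt by (intro det2_in_Ints point_coords_Ints)
    hence "1 \<le> \<bar>det2 f g (z l) (z (Suc l))\<bar>" using fg(3) by (rule Ints_nonzero_abs_ge1)
    also have "\<dots> \<le> (3 * C) * ((3 * C) * (K * (X (Suc l) * L l)))"
      using form[of l] fg by (intro det2_point_bound[OF C]) (auto simp: l_def)
    also have "\<dots> < 1" by (rule M) (simp add: l_def)
    finally show False by simp
  qed
  hence "q \<bullet> v = 0" unfolding v \<theta> by simp
  moreover have "q \<bullet> y = 0" using yq by (simp add: orthogonal_def)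
  ultimately have "q = 0" unfolding yq(3) by (simp add: inner_add_right)
  thus "v \<in> S" using yq S(1) by (simp add: span_eq_iff[THEN iffD2])
qed

text \<open>Otherwise all late minimal points lie in one plane, which contains the graph and by
  dimension equals it; but no minimal point is on the graph, as its error is positive.\<close>

lemma nonplanar_triples:
  assumes lim: "(\<lambda>l. X (Suc l) * L l) \<longlonglongrightarrow> 0"
  shows "\<exists>l\<ge>N. z (Suc (Suc l)) \<notin> span {z l, z (Suc l)}"
proof (rule ccontr)
  assume "\<not> ?thesis"
  hence planar: "z (Suc (Suc l)) \<in> span {z l, z (Suc l)}" if "N \<le> l" for l using that by blast
  define S where "S = span {z N, z (Suc N)}"
  have "z l \<in> S \<and> z (Suc l) \<in> S" if "N \<le> l" for l
    using that
  proof (induction l rule: dec_induct)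
    case base
    show ?case unfolding S_def by (simp add: span_base)
  next
    case (step l)
    hence "span {z l, z (Suc l)} \<subseteq> S" unfolding S_def by (intro span_minimal) auto
    thus ?case using planar[of l] step by blast
  qed
  hence "graph_space \<xi> \<subseteq> S"
    by (intro graph_subset_of_eventual_subspace[OF _ _ lim]) (auto simp: S_def)
  moreover have "dim S \<le> dim (graph_space \<xi>)"
  proof -
    have "dim S \<le> card {z N, z (Suc N)}" unfolding S_def dim_span by (rule dim_le_card') simp
    also have "\<dots> \<le> 2" by (simp add: card_insert_if)
    finally show ?thesis by (simp add: graph_space_dim)
  qed
  ultimately have "graph_space \<xi> = S"
    by (intro subspace_dim_equal graph_space_subspace) (auto simp: S_def)
  hence "z N \<in> graph_space \<xi>" unfolding S_def by (simp add: span_base)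
  hence "err \<xi> (z N) = 0" unfolding graph_space_def err_def by (auto simp: infnorm_0)
  thus False using err_pos[of N] by simp
qed

text \<open>Without such a pair, all points from some independent triple on stay in its span, which
  is rational of dimension 3 and contains the graph.\<close>

lemma independent_quadruples:
  assumes lim: "(\<lambda>l. X (Suc l) * L l) \<longlonglongrightarrow> 0"
    and no_rational: "\<not> (\<exists>S. rational_subspace S \<and> dim S = 3 \<and> graph_space \<xi> \<subseteq> S)"
  obtains i j where "N \<le> i" "i < j" "z (Suc (Suc i)) \<notin> span {z i, z (Suc i)}"
    "\<And>l. i < l \<Longrightarrow> l < j \<Longrightarrow> z (Suc (Suc l)) \<in> span {z l, z (Suc l)}"
    "z (Suc (Suc j)) \<notin> span {z i, z (Suc i), z (Suc (Suc i))}"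
proof (rule ccontr)
  assume contra: "\<not> thesis"
  note result = that
  obtain i0 where i0: "N \<le> i0" "z (Suc (Suc i0)) \<notin> span {z i0, z (Suc i0)}"
    using nonplanar_triples[OF lim] by blast
  let ?B = "{z (Suc (Suc i0)), z (Suc i0), z i0}"
  define S where "S = span ?B"
  have base: "z i0 \<in> S" "z (Suc i0) \<in> S" "z (Suc (Suc i0)) \<in> S"
    unfolding S_def by (simp_all add: span_base)
  have in_S: "z l \<in> S" if "i0 \<le> l" for l
    using that
  proof (induction l rule: less_induct)
    case (less l)
    have "l = i0 \<or> l = Suc i0 \<or> l = Suc (Suc i0) \<or> (l = Suc (Suc (l - 2)) \<and> i0 < l - 2)"
      using less(2) by arith
    then consider "l = i0" | "l = Suc i0" | "l = Suc (Suc i0)" | m where "l = Suc (Suc m)" "i0 < m"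
      by blast
    thus ?case
    proof cases
      case (4 m)
      have IH: "z k \<in> S" if "i0 \<le> k" "k \<le> Suc m" for k using less(1)[of k] that 4 by simp
      show ?thesis
      proof (cases "z (Suc (Suc m)) \<in> span {z m, z (Suc m)}")
        case True
        moreover have "span {z m, z (Suc m)} \<subseteq> S"
          using IH 4(2) unfolding S_def by (intro span_minimal) auto
        ultimately show ?thesis using 4 by blast
      next
        case False
        \<comment> \<open>The last independent triple before \<open>m\<close> is followed by
          dependent ones up to \<open>m\<close>, so only the last clause of the claim can fail: the
          new point lies in the span of that triple, which is inside \<open>S\<close> by
          induction.\<close>
        define I where "I = {i. i0 \<le> i \<and> i < m \<and> z (Suc (Suc i)) \<notin> span {z i, z (Suc i)}}"
        have fin: "finite I" unfolding I_def by (rule finite_subset[of _ "{..<m}"]) auto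
        have "i0 \<in> I" unfolding I_def using i0 4 by simp
        define i where "i = Max I"
        have "i \<in> I" unfolding i_def using fin \<open>i0 \<in> I\<close> by (intro Max_in) auto
        hence i: "i0 \<le> i" "i < m" "z (Suc (Suc i)) \<notin> span {z i, z (Suc i)}" unfolding I_def by auto
        have run: "z (Suc (Suc l)) \<in> span {z l, z (Suc l)}" if "i < l" "l < m" for l
        proof (rule ccontr)
          assume "\<not> ?thesis"
          hence "l \<in> I" unfolding I_def using that i by simp
          hence "l \<le> i" unfolding i_def using fin by simp
          thus False using that by simp
        qed
        have "z (Suc (Suc m)) \<in> span {z i, z (Suc i), z (Suc (Suc i))}"
        proof (rule ccontr)
          assume "\<not> ?thesis"
          hence thesis using i run i0(1) by (intro result[of i m]) auto
          thus False using contra by simp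
        qed
        moreover have "span {z i, z (Suc i), z (Suc (Suc i))} \<subseteq> S"
          using IH i unfolding S_def by (intro span_minimal) auto
        ultimately show ?thesis using 4 by blast
      qed
    qed (use base in simp_all)
  qed
  hence "graph_space \<xi> \<subseteq> S"
    by (intro graph_subset_of_eventual_subspace[OF _ _ lim]) (auto simp: S_def)
  moreover have "rational_subspace S"
  proof -
    have "(\<forall>k. fst (z l) $ k \<in> \<rat>) \<and> (\<forall>j. snd (z l) $ j \<in> \<rat>)" for l
      using int_pt[of l] unfolding int_points_def by (auto simp: rvec_def)
    hence "\<forall>(x, y)\<in>?B. (\<forall>k. x $ k \<in> \<rat>) \<and> (\<forall>j. y $ j \<in> \<rat>)" by (auto simp: case_prod_beta)
    thus ?thesis unfolding rational_subspace_def S_def by blast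
  qed
  moreover have "dim S = 3"
  proof -
    have "z (Suc (Suc i0)) \<notin> span {z (Suc i0), z i0}" using i0(2) by (simp add: insert_commute)
    moreover have "z (Suc i0) \<notin> span {z i0}" by (rule not_parallel)
    moreover have "z i0 \<notin> span {}" using z_nonzero by simp
    ultimately show ?thesis unfolding S_def dim_span by (simp add: dim_insert)
  qed
  ultimately show False using no_rational by blast
qed

section \<open>Lower bounds from nonzero integer minors\<close>

lemma nonplanar_triple_bound:
  obtains K where "0 < K" "\<And>l. z (Suc (Suc l)) \<notin> span {z l, z (Suc l)} \<Longrightarrow>
    1 \<le> K * (L l * X (Suc l) * X (Suc (Suc l)))"
proof -
  obtain C where C: "1 \<le> C" "\<And>j k. \<bar>\<xi> $ j $ k\<bar> \<le> C" using matrix_entries_bounded by metis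
  show thesis
  proof (rule that[of "(3 * C) * ((3 * C) * ((3 * C) * 6))"])
    show "0 < (3 * C) * ((3 * C) * ((3 * C) * 6))" using C(1) by simp
    fix l assume np: "z (Suc (Suc l)) \<notin> span {z l, z (Suc l)}"
    obtain f g where fg: "f \<in> point_coords" "g \<in> point_coords" "det2 f g (z l) (z (Suc l)) \<noteq> 0"
      using det2_nonzero[OF z_nonzero not_parallel, of l] by metis
    obtain h where h: "h \<in> point_coords" "det3 h f g (z l) (z (Suc l)) (z (Suc (Suc l))) \<noteq> 0"
      using det3_nonzero[OF fg np] by metis
    \<comment> \<open>A nonzero integer is at least 1 in absolute value, while exchanging three rows
      for forms costs (3C)^3.\<close>
    have "det3 h f g (z l) (z (Suc l)) (z (Suc (Suc l))) \<in> \<int>"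
      using fg h int_pt by (intro det3_in_Ints)
    hence "1 \<le> \<bar>det3 h f g (z l) (z (Suc l)) (z (Suc (Suc l)))\<bar>"
      using h(2) by (rule Ints_nonzero_abs_ge1)
    also have "\<dots> \<le> (3 * C) * ((3 * C) * ((3 * C) * (6 * (L l * X (Suc l) * X (Suc (Suc l))))))"
      using fg h by (intro det3_point_bound[OF C] det3_form_bound X_mono L_antimono L_le_X) simp_all
    finally show "1 \<le> (3 * C) * ((3 * C) * ((3 * C) * 6)) * (L l * X (Suc l) * X (Suc (Suc l)))"
      by (simp only: mult.assoc)
  qed
qed

text \<open>The span conditions make the four points independent, and \<open>i < j\<close> keeps
  them ordered by height, so the first two carry the largest errors and the last two the largest
  heights.\<close>

lemma quadruple_bound:
  obtains K where "0 < K" "\<And>i j. i < j \<Longrightarrow> z (Suc (Suc i)) \<notin> span {z i, z (Suc i)} \<Longrightarrow>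
    z (Suc (Suc j)) \<notin> span {z i, z (Suc i), z (Suc (Suc i))} \<Longrightarrow>
    1 \<le> K * (L i * L (Suc i) * X (Suc (Suc i)) * X (Suc (Suc j)))"
proof -
  obtain C where C: "1 \<le> C" "\<And>j k. \<bar>\<xi> $ j $ k\<bar> \<le> C" using matrix_entries_bounded by metis
  show thesis
  proof (rule that[of "(3 * C) * ((3 * C) * ((3 * C) * ((3 * C) * 24)))"])
    show "0 < (3 * C) * ((3 * C) * ((3 * C) * ((3 * C) * 24)))" using C(1) by simp
    fix i j assume "i < j" and np: "z (Suc (Suc i)) \<notin> span {z i, z (Suc i)}"
      "z (Suc (Suc j)) \<notin> span {z i, z (Suc i), z (Suc (Suc i))}"
    let ?D = "\<lambda>k h f g. det4 k h f g (z i) (z (Suc i)) (z (Suc (Suc i))) (z (Suc (Suc j)))"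
    obtain f g where fg: "f \<in> point_coords" "g \<in> point_coords" "det2 f g (z i) (z (Suc i)) \<noteq> 0"
      using det2_nonzero[OF z_nonzero not_parallel, of i] by metis
    obtain h where h: "h \<in> point_coords" "det3 h f g (z i) (z (Suc i)) (z (Suc (Suc i))) \<noteq> 0"
      using det3_nonzero[OF fg np(1)] by metis
    obtain k where k: "k \<in> point_coords" "?D k h f g \<noteq> 0"
      using det4_nonzero[OF h(1) fg(1,2) h(2) np(2)] by metis
    have "?D k h f g \<in> \<int>" using fg h k int_pt by (intro det4_in_Ints)
    hence "1 \<le> \<bar>?D k h f g\<bar>" using k(2) by (rule Ints_nonzero_abs_ge1)
    also have "\<dots> \<le> (3 * C) * ((3 * C) * ((3 * C) * ((3 * C) *
        (24 * (L i * L (Suc i) * X (Suc (Suc i)) * X (Suc (Suc j)))))))"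
      using fg h k \<open>i < j\<close>
      by (intro det4_point_bound[OF C] det4_form_bound X_mono L_antimono L_le_X) simp_all
    finally show "1 \<le> (3 * C) * ((3 * C) * ((3 * C) * ((3 * C) * 24))) *
        (L i * L (Suc i) * X (Suc (Suc i)) * X (Suc (Suc j)))"
      by (simp only: mult.assoc)
  qed
qed

section \<open>From decay of the errors to bounds on the exponent\<close>

lemma decay_limit:
  assumes "1 < w" and decay: "\<forall>\<^sub>F i in sequentially. L i \<le> c * X (Suc i) powr (- w)"
  shows "(\<lambda>l. X (Suc l) * L l) \<longlonglongrightarrow> 0"
proof (rule tendsto_sandwich[of "\<lambda>_. 0" _ _ "\<lambda>l. c * X (Suc l) powr (1 - w)"])
  have top: "filterlim (\<lambda>i. X (Suc i)) at_top sequentially"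
    using X_at_top by (rule filterlim_compose[OF _ filterlim_Suc])
  have "(\<lambda>l. c * X (Suc l) powr (1 - w)) \<longlonglongrightarrow> c * 0"
    using assms(1) by (intro tendsto_mult tendsto_const tendsto_neg_powr top) simp
  thus "(\<lambda>l. c * X (Suc l) powr (1 - w)) \<longlonglongrightarrow> 0" by simp
  show "\<forall>\<^sub>F l in sequentially. X (Suc l) * L l \<le> c * X (Suc l) powr (1 - w)"
    using decay
  proof eventually_elim
    case (elim l)
    hence "X (Suc l) * L l \<le> X (Suc l) * (c * X (Suc l) powr (- w))"
      by (intro mult_left_mono) (simp_all add: ht_nonneg)
    also have "\<dots> = c * X (Suc l) powr (1 - w)"
      using powr_add[of "X (Suc l)" 1 "- w"] X_ge_1[of "Suc l"] by simp
    finally show ?case .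
  qed
qed (simp_all add: ht_nonneg err_nonneg)

text \<open>Decay is inserted into the bound for independent triples. Under (B),
  \<open>X (Suc (Suc l))\<close> is at most a multiple of \<open>X (Suc l)\<close>; under (C),
  \<open>L l\<close> is at most a multiple of \<open>L (Suc l)\<close>, which decays in terms of
  \<open>X (Suc (Suc l))\<close>. Either way a constant times a height to the power 2 - w is at
  least 1 arbitrarily far out.\<close>

lemma exponent_le_2:
  assumes decay: "\<forall>\<^sub>F i in sequentially. L i \<le> c * X (Suc i) powr (- w)" and "1 < w" "0 < c"
    and bounded: "(\<forall>i. X (Suc i) \<le> R * X i) \<or> (\<forall>i. L i \<le> R * L (Suc i))"
  shows "w \<le> 2"
proof (rule ccontr)
  assume "\<not> w \<le> 2"
  hence w: "2 - w < 0" by simp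
  have powr_eq: "X i powr (- w) * (X i * X i) = X i powr (2 - w)" for i
    using powr_add[of "X i" "- w" 2] X_ge_1[of i] by (simp add: power2_eq_square)
  have lim: "(\<lambda>l. X (Suc l) * L l) \<longlonglongrightarrow> 0" using \<open>1 < w\<close> decay by (rule decay_limit)
  have top: "filterlim (\<lambda>i. X (Suc i)) at_top sequentially"
    using X_at_top by (rule filterlim_compose[OF _ filterlim_Suc])
  obtain K where K: "0 < K" "\<And>l. z (Suc (Suc l)) \<notin> span {z l, z (Suc l)} \<Longrightarrow>
    1 \<le> K * (L l * X (Suc l) * X (Suc (Suc l)))"
    using nonplanar_triple_bound by metis
  from bounded show False
  proof
    assume B: "\<forall>i. X (Suc i) \<le> R * X i"
    show False
    proof (rule frequently_ge_1_absurd[OF top w decay])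
      fix N
      obtain l where l: "N \<le> l" "z (Suc (Suc l)) \<notin> span {z l, z (Suc l)}"
        using nonplanar_triples[OF lim] by blast
      have "1 \<le> K * c * R * X (Suc l) powr (2 - w)" if "L l \<le> c * X (Suc l) powr (- w)"
      proof -
        have "1 \<le> K * (L l * X (Suc l) * X (Suc (Suc l)))" using K(2) l(2) .
        also have "\<dots> \<le> K * ((c * X (Suc l) powr (- w)) * X (Suc l) * (R * X (Suc l)))"
          using K(1) B that \<open>0 < c\<close>
          by (intro mult_left_mono mult_mono mult_nonneg_nonneg) (auto simp: ht_nonneg err_nonneg)
        also have "\<dots> = K * c * R * (X (Suc l) powr (- w) * (X (Suc l) * X (Suc l)))"
          by (simp only: mult_ac)
        finally show ?thesis unfolding powr_eq .
      qed
      thus "\<exists>l\<ge>N. L l \<le> c * X (Suc l) powr (- w) \<longrightarrow> 1 \<le> K * c * R * X (Suc l) powr (2 - w)"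
        using l(1) by blast
    qed
  next
    assume C: "\<forall>i. L i \<le> R * L (Suc i)"
    have top2: "filterlim (\<lambda>i. X (Suc (Suc i))) at_top sequentially"
      using top by (rule filterlim_compose[OF _ filterlim_Suc])
    have "0 < R * L 1" using C[rule_format, of 0] err_pos[of 0] by simp
    hence "0 < R" using err_pos[of 1] by (simp add: zero_less_mult_iff)
    have decay2: "\<forall>\<^sub>F i in sequentially. L (Suc i) \<le> c * X (Suc (Suc i)) powr (- w)"
      using eventually_sequentially_Suc[of "\<lambda>i. L i \<le> c * X (Suc i) powr (- w)", THEN iffD2] decay
      by blast
    show False
    proof (rule frequently_ge_1_absurd[OF top2 w decay2])
      fix N
      obtain l where l: "N \<le> l" "z (Suc (Suc l)) \<notin> span {z l, z (Suc l)}"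
        using nonplanar_triples[OF lim] by blast
      have "1 \<le> K * c * R * X (Suc (Suc l)) powr (2 - w)"
        if "L (Suc l) \<le> c * X (Suc (Suc l)) powr (- w)"
      proof -
        have "1 \<le> K * (L l * X (Suc l) * X (Suc (Suc l)))" using K(2) l(2) .
        also have "\<dots> \<le> K * ((R * (c * X (Suc (Suc l)) powr (- w))) * X (Suc (Suc l)) * X (Suc (Suc l)))"
        proof (intro mult_left_mono mult_mono mult_nonneg_nonneg)
          have "L l \<le> R * L (Suc l)" using C by blast
          also have "\<dots> \<le> R * (c * X (Suc (Suc l)) powr (- w))"
            using that \<open>0 < R\<close> by (intro mult_left_mono) auto
          finally show "L l \<le> R * (c * X (Suc (Suc l)) powr (- w))" .
        qed (use K(1) \<open>0 < c\<close> \<open>0 < R\<close> ht_Suc[of "Suc l"] in \<open>auto simp: ht_nonneg err_nonneg\<close>)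
        also have "\<dots> = K * c * R * (X (Suc (Suc l)) powr (- w) * (X (Suc (Suc l)) * X (Suc (Suc l))))"
          by (simp only: mult_ac)
        finally show ?thesis unfolding powr_eq .
      qed
      thus "\<exists>l\<ge>N. L (Suc l) \<le> c * X (Suc (Suc l)) powr (- w) \<longrightarrow>
          1 \<le> K * c * R * X (Suc (Suc l)) powr (2 - w)"
        using l(1) by blast
    qed
  qed
qed

text \<open>Triple and quadruple bounds multiply to (a b)^3 Y, so an estimate of a b along the run
  suffices; the final exponent is 3 (1 - w) + 1.\<close>

lemma exponent_le_4_3:
  assumes decay: "\<forall>\<^sub>F i in sequentially. L i \<le> c * X (Suc i) powr (- w)" and "1 < w" "0 < c"
    and B: "\<And>i. X (Suc i) \<le> R * X i" and C: "\<And>i. L i \<le> R * L (Suc i)" and "0 < R"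
    and no_rational: "\<not> (\<exists>S. rational_subspace S \<and> dim S = 3 \<and> graph_space \<xi> \<subseteq> S)"
  shows "w \<le> 4 / 3"
proof (rule ccontr)
  assume "\<not> w \<le> 4 / 3"
  hence w: "4 - 3 * w < 0" by simp
  have lim: "(\<lambda>l. X (Suc l) * L l) \<longlonglongrightarrow> 0" using \<open>1 < w\<close> decay by (rule decay_limit)
  have top: "filterlim (\<lambda>i. X (Suc i)) at_top sequentially"
    using X_at_top by (rule filterlim_compose[OF _ filterlim_Suc])
  obtain K where K: "0 < K" "\<And>l. z (Suc (Suc l)) \<notin> span {z l, z (Suc l)} \<Longrightarrow>
    1 \<le> K * (L l * X (Suc l) * X (Suc (Suc l)))"
    using nonplanar_triple_bound by metis
  obtain K' where K': "0 < K'" "\<And>i j. i < j \<Longrightarrow> z (Suc (Suc i)) \<notin> span {z i, z (Suc i)} \<Longrightarrow>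
    z (Suc (Suc j)) \<notin> span {z i, z (Suc i), z (Suc (Suc i))} \<Longrightarrow>
    1 \<le> K' * (L i * L (Suc i) * X (Suc (Suc i)) * X (Suc (Suc j)))"
    using quadruple_bound by metis
  \<comment> \<open>\<open>K * R\<close> comes from the triple, \<open>K' * R * R\<close> from the
    quadruple, and the cube from the run.\<close>
  define M where "M = K * R * (K' * R * R) * (8 * c) ^ 3"
  show False
  proof (rule frequently_ge_1_absurd[OF top w decay])
    fix N
    obtain i j where ij: "N \<le> i" "i < j" "z (Suc (Suc i)) \<notin> span {z i, z (Suc i)}"
      "\<And>l. i < l \<Longrightarrow> l < j \<Longrightarrow> z (Suc (Suc l)) \<in> span {z l, z (Suc l)}"
      "z (Suc (Suc j)) \<notin> span {z i, z (Suc i), z (Suc (Suc i))}"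
      using independent_quadruples[OF lim no_rational, of N] by metis
    have "1 \<le> M * X (Suc j) powr (4 - 3 * w)" if dec: "L j \<le> c * X (Suc j) powr (- w)"
    proof -
      define a b Y where "a = X (Suc (Suc i))" and "b = L (Suc i)" and "Y = X (Suc j)"
      have pos: "0 < a" "0 < b" "1 \<le> Y"
        using X_ge_1[of "Suc (Suc i)"] err_pos X_ge_1[of "Suc j"] by (simp_all add: a_def b_def Y_def)
      have Li: "L i \<le> R * b" unfolding b_def by (rule C)
      have "1 \<le> K * (L i * X (Suc i) * a)" unfolding a_def using K(2) ij(3) .
      also have "\<dots> \<le> K * ((R * b) * a * a)"
        using K(1) Li pos \<open>0 < R\<close> ht_Suc[of "Suc i"]
        by (intro mult_left_mono mult_mono) (auto simp: a_def ht_nonneg)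
      finally have triple: "1 \<le> K * R * (a * a * b)" by (simp only: mult_ac)
      \<comment> \<open>(C) trades \<open>L i\<close> for \<open>b\<close> and (B) trades
        \<open>X (Suc (Suc j))\<close> for \<open>Y\<close>, each at the cost of a factor
        \<open>R\<close>.\<close>
      have "1 \<le> K' * (L i * b * a * X (Suc (Suc j)))" unfolding a_def b_def using K'(2) ij(2,3,5) .
      also have "\<dots> \<le> K' * ((R * b) * b * a * (R * Y))"
        using K'(1) Li pos \<open>0 < R\<close> B[of "Suc j"]
        by (intro mult_left_mono mult_mono) (auto simp: Y_def ht_nonneg)
      finally have quadruple: "1 \<le> K' * R * R * (Y * a * b * b)" by (simp only: mult_ac)
      \<comment> \<open>The dependent run begins one step after the independent triple, so
        \<open>Suc i\<close> is compared with \<open>j\<close>.\<close>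
      have "a * b \<le> 8 * (Y * L j)"
        unfolding a_def b_def Y_def using ij(2,4) by (intro planar_run_comparison) auto
      also have "\<dots> \<le> 8 * (Y * (c * Y powr (- w)))"
        using dec pos by (intro mult_left_mono) (auto simp: Y_def)
      also have "\<dots> = 8 * c * Y powr (1 - w)"
        using powr_add[of Y 1 "- w"] pos by simp
      finally have ab: "a * b \<le> 8 * c * Y powr (1 - w)" .
      have "1 * 1 \<le> (K * R * (a * a * b)) * (K' * R * R * (Y * a * b * b))"
        using triple quadruple by (intro mult_mono) auto
      also have "\<dots> = K * R * (K' * R * R) * ((a * b) ^ 3 * Y)"
        by (simp only: power3_eq_cube mult_ac)
      also have "\<dots> \<le> K * R * (K' * R * R) * ((8 * c * Y powr (1 - w)) ^ 3 * Y)"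
        using ab pos K(1) K'(1) \<open>0 < R\<close> by (intro mult_left_mono mult_right_mono power_mono) auto
      also have "(8 * c * Y powr (1 - w)) ^ 3 * Y = (8 * c) ^ 3 * Y powr (4 - 3 * w)"
      proof -
        have "(Y powr (1 - w)) ^ 3 * Y = Y powr (3 * (1 - w)) * Y powr 1"
          using pos by (simp add: powr_power mult.commute)
        also have "\<dots> = Y powr (4 - 3 * w)"
          unfolding powr_add[symmetric] by (simp add: algebra_simps)
        finally show ?thesis by (simp only: power_mult_distrib mult.assoc)
      qed
      finally show ?thesis by (simp only: M_def Y_def mult.assoc mult_1)
    qed
    moreover have "N \<le> j" using ij by simp
    ultimately show "\<exists>j\<ge>N. L j \<le> c * X (Suc j) powr (- w) \<longrightarrow> 1 \<le> M * X (Suc j) powr (4 - 3 * w)"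
      by blast
  qed
qed

text \<open>Stated for every \<open>r\<close> from some \<open>R\<close> on, so that (B) and (C) can
  share one constant.\<close>

lemma property_B_bound:
  assumes "\<And>i. X i = jump_point \<xi> i" "property_B \<xi>"
  obtains R where "\<And>r i. R \<le> r \<Longrightarrow> X (Suc i) \<le> r * X i"
proof -
  obtain R where R: "\<And>i. X (Suc i) / X i \<le> R"
    using assms(2) unfolding property_B_def assms(1)[symmetric] bdd_above_def by blast
  have "X (Suc i) \<le> r * X i" if "R \<le> r" for r i
    using order_trans[OF R that, of i] X_ge_1[of i] by (simp add: pos_divide_le_eq)
  thus thesis by (rule that)
qed

lemma property_C_bound:
  assumes "\<And>i. L i = jump_value \<xi> i" "property_C \<xi>"
  obtains R where "\<And>r i. R \<le> r \<Longrightarrow> L i \<le> r * L (Suc i)"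
proof -
  obtain R where R: "\<And>i. L i / L (Suc i) \<le> R"
    using assms(2) unfolding property_C_def assms(1)[symmetric] bdd_above_def by blast
  have "L i \<le> r * L (Suc i)" if "R \<le> r" for r i
    using order_trans[OF R that, of i] err_pos[of "Suc i"] by (simp add: pos_divide_le_eq)
  thus thesis by (rule that)
qed

end

section \<open>Minimal points of the step function\<close>

lemma jump_point_nat:
  assumes "totally_irrational \<xi>" "(min_fun \<xi> \<longlongrightarrow> 0) at_top"
  shows "\<exists>N\<ge>1. jump_point \<xi> i = real N"
proof (induction i)
  case 0
  show ?case by (intro exI[of _ 1]) simp
next
  case (Suc i)
  then obtain N where N: "1 \<le> N" "jump_point \<xi> i = real N" by blast
  obtain M where "N < M" "(LEAST X. real N < X \<and> \<not> isCont (min_fun \<xi>) X) = real M"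
    by (rule next_jump[OF assms N(1)])
  thus ?case using N by (intro exI[of _ M]) simp
qed

text \<open>The sequence consists of minimizers at the jump points; the main point is that their
  heights equal the jump points.\<close>

lemma minimal_points_exist:
  fixes \<xi> :: "real^2^'n"
  assumes "totally_irrational \<xi>" "(min_fun \<xi> \<longlongrightarrow> 0) at_top"
  obtains z where "minimal_points \<xi> z" "\<And>i. ht (z i) = jump_point \<xi> i"
    "\<And>i. err \<xi> (z i) = jump_value \<xi> i"
proof -
  let ?X = "jump_point \<xi>" and ?L = "jump_value \<xi>"
  have ge_1: "1 \<le> ?X i" for i using jump_point_nat[OF assms, of i] by auto
  have step: "?X i < ?X (Suc i)" "?L (Suc i) < ?L i"
    "\<And>Y. ?X i \<le> Y \<Longrightarrow> Y < ?X (Suc i) \<Longrightarrow> min_fun \<xi> Y = ?L i" for i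
  proof -
    obtain N where N: "1 \<le> N" "?X i = real N" using jump_point_nat[OF assms, of i] by blast
    obtain M where M: "N < M" "(LEAST X. real N < X \<and> \<not> isCont (min_fun \<xi>) X) = real M"
      "min_fun \<xi> (real M) < min_fun \<xi> (real N)"
      "\<forall>X. real N \<le> X \<longrightarrow> X < real M \<longrightarrow> min_fun \<xi> X = min_fun \<xi> (real N)"
      by (rule next_jump[OF assms N(1)])
    have Suc: "?X (Suc i) = real M" using M(2) N(2) by simp
    show "?X i < ?X (Suc i)" "?L (Suc i) < ?L i" using M(1,3) N(2) Suc by (simp_all add: jump_value_def)
    show "min_fun \<xi> Y = ?L i" if "?X i \<le> Y" "Y < ?X (Suc i)" for Y
      unfolding jump_value_def N(2) using that unfolding Suc N(2) by (rule M(4)[rule_format])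
  qed
  have "\<exists>p \<in> int_points. 0 < ht p \<and> ht p \<le> ?X i \<and> err \<xi> p = ?L i" for i
  proof -
    obtain x y where "0 < infnorm (rvec x)" "infnorm (rvec x) \<le> ?X i"
      "lin_form \<xi> x y = min_fun \<xi> (?X i)"
      using min_fun_attained[OF ge_1] by metis
    thus ?thesis
      by (intro bexI[of _ "(rvec x, rvec y)"])
        (auto simp: int_points_def ht_def err_def jump_value_def lin_form_def[symmetric])
  qed
  then obtain z where z: "\<And>i. z i \<in> int_points" "\<And>i. 0 < ht (z i)" "\<And>i. ht (z i) \<le> ?X i"
    "\<And>i. err \<xi> (z i) = ?L i"
    by metis
  have min_fun_le_err: "min_fun \<xi> Y \<le> err \<xi> p" if "p \<in> int_points" "0 < ht p" "ht p \<le> Y" for p Y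
    using that unfolding int_points_def ht_def err_def lin_form_def[symmetric]
    by (auto simp: lin_form_def[symmetric] intro!: min_fun_le)
  have ge_1_of_pos: "1 \<le> ht p" if "p \<in> int_points" "0 < ht p" for p
  proof -
    have "ht p \<in> \<int>" using that(1) unfolding int_points_def ht_def by (auto simp: infnorm_rvec_int)
    thus ?thesis using that(2) Ints_nonzero_abs_ge1[of "ht p"] by simp
  qed
  have ht_z: "ht (z i) = ?X i" for i
  proof (cases i)
    case 0
    thus ?thesis using z(3)[of 0] ge_1_of_pos[OF z(1,2), of 0] by simp
  next
    case (Suc k)
    show ?thesis
    proof (rule ccontr)
      assume "ht (z i) \<noteq> ?X i"
      hence less: "ht (z i) < ?X (Suc k)" using z(3)[of i] Suc by simp
      \<comment> \<open>\<open>Y\<close> lies before the jump, where the step function still has the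
        larger value \<open>?L k\<close>, yet it already admits \<open>z i\<close>.\<close>
      define Y where "Y = max (ht (z i)) (?X k)"
      have "min_fun \<xi> Y = ?L k" using less step(1)[of k] by (intro step(3)) (auto simp: Y_def)
      moreover have "min_fun \<xi> Y \<le> err \<xi> (z i)"
        using z by (intro min_fun_le_err) (auto simp: Y_def)
      ultimately show False using z(4)[of i] step(2)[of k] Suc by simp
    qed
  qed
  have L_antimono: "?L i \<le> ?L 0" for i
    by (rule lift_Suc_antimono_le[of ?L]) (use step(2) in \<open>auto intro: less_imp_le\<close>)
  have L_pos: "0 < ?L i" for i
    unfolding jump_value_def using assms(1) ge_1 by (rule min_fun_pos)
  have "?L 0 \<le> 1"
  proof -
    define e :: "int^2" where "e = (\<chi> i. 1)"
    define y :: "int^'n" where "y = (\<chi> j. round ((\<xi> *v rvec e) $ j))"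
    have e: "infnorm (rvec e) = 1"
      by (rule infnorm_attained[of "rvec e"]) (simp add: e_def rvec_def)
    have "lin_form \<xi> e y \<le> 1"
      unfolding lin_form_def infnorm_le_iff
    proof
      fix j
      show "\<bar>(\<xi> *v rvec e - rvec y) $ j\<bar> \<le> 1"
        using of_int_round_abs_le[of "(\<xi> *v rvec e) $ j"]
        by (simp add: y_def rvec_def abs_minus_commute)
    qed
    moreover have "?L 0 \<le> lin_form \<xi> e y"
      unfolding jump_value_def using e by (intro min_fun_le) auto
    ultimately show ?thesis by simp
  qed
  have "minimal_points \<xi> z"
  proof
    fix i
    show "z i \<in> int_points" "1 \<le> ht (z 0)" "ht (z i) < ht (z (Suc i))"
      "err \<xi> (z (Suc i)) < err \<xi> (z i)" "0 < err \<xi> (z i)" "err \<xi> (z i) \<le> 1"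
      using z ge_1 step(1)[of i] step(2)[of i] L_pos L_antimono[of i] \<open>?L 0 \<le> 1\<close>
      by (simp_all add: ht_z del: jump_point.simps)
    fix p :: "(real^2) \<times> (real^'n)"
    assume p: "p \<in> int_points" "p \<noteq> 0" "ht p < ht (z (Suc i))"
    show "err \<xi> (z i) \<le> err \<xi> p"
    proof (cases "0 < ht p")
      case True
      define Y where "Y = max (ht p) (?X i)"
      have "min_fun \<xi> Y = ?L i"
        using p(3) step(1)[of i] by (intro step(3)) (auto simp: Y_def ht_z simp del: jump_point.simps)
      moreover have "min_fun \<xi> Y \<le> err \<xi> p"
        using p True by (intro min_fun_le_err) (auto simp: Y_def)
      ultimately show ?thesis using z(4)[of i] by simp
    next
      \<comment> \<open>With first component 0 the error is the sup-norm of a nonzero integer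
        vector, hence at least 1.\<close>
      case False
      hence "fst p = 0" using ht_nonneg[of p] by (simp add: ht_def infnorm_eq_0)
      moreover obtain x y where xy: "p = (rvec x, rvec y)" using p(1) unfolding int_points_def by blast
      ultimately have "err \<xi> p = infnorm (rvec y)" by (simp add: err_def infnorm_neg)
      moreover have "infnorm (rvec y) \<noteq> 0"
        using p(2) \<open>fst p = 0\<close> xy by (auto simp: infnorm_eq_0 zero_prod_def)
      hence "1 \<le> \<bar>infnorm (rvec y)\<bar>" using infnorm_rvec_int by (intro Ints_nonzero_abs_ge1)
      ultimately have "1 \<le> err \<xi> p" by (simp add: infnorm_pos_le)
      thus ?thesis using z(4)[of i] L_antimono[of i] \<open>?L 0 \<le> 1\<close> by simp
    qed
  qed
  thus thesis using that ht_z z(4) by blast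
qed

text \<open>The exponent condition is evaluated at half of \<open>X (Suc i)\<close>, because
  minimality covers only heights strictly below \<open>X (Suc i)\<close>; this costs the factor
  \<open>2 powr w\<close>. The condition also makes the step function tend to 0, so that the minimal
  points exist.\<close>

lemma minimal_points_decay:
  fixes \<xi> :: "real^2^'n"
  assumes "totally_irrational \<xi>" "1 < w"
    and ev: "\<forall>\<^sub>F X in at_top. \<exists>x y. 0 < infnorm (rvec x) \<and> infnorm (rvec x) \<le> X \<and>
      lin_form \<xi> x y < X powr (- w)"
  obtains z c where "minimal_points \<xi> z" "\<forall>i. ht (z i) = jump_point \<xi> i"
    "\<forall>i. err \<xi> (z i) = jump_value \<xi> i" "0 < c"
    "\<forall>\<^sub>F i in sequentially. err \<xi> (z i) \<le> c * ht (z (Suc i)) powr (- w)"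
proof -
  have "(min_fun \<xi> \<longlongrightarrow> 0) at_top"
  proof (rule tendsto_sandwich[of "\<lambda>_. 0" _ _ "\<lambda>X. X powr (- w)"])
    show "\<forall>\<^sub>F X in at_top. 0 \<le> min_fun \<xi> X"
      using eventually_ge_at_top[of 1]
      by eventually_elim (rule less_imp_le[OF min_fun_pos[OF assms(1)]])
    show "\<forall>\<^sub>F X in at_top. min_fun \<xi> X \<le> X powr (- w)"
      using ev by eventually_elim (meson min_fun_le less_imp_le order_trans)
    show "((\<lambda>X. X powr (- w)) \<longlongrightarrow> 0) at_top"
      using assms(2) by (intro tendsto_neg_powr filterlim_ident) simp
  qed simp
  then obtain z where z: "minimal_points \<xi> z" "\<forall>i. ht (z i) = jump_point \<xi> i"
    "\<forall>i. err \<xi> (z i) = jump_value \<xi> i"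
    by (rule minimal_points_exist[OF assms(1)]) blast
  interpret minimal_points \<xi> z by (rule z(1))
  have "filterlim (\<lambda>i. X (Suc i)) at_top sequentially"
    using X_at_top by (rule filterlim_compose[OF _ filterlim_Suc])
  hence "filterlim (\<lambda>i. 1 / 2 * X (Suc i)) at_top sequentially"
    by (intro filterlim_tendsto_pos_mult_at_top[OF tendsto_const]) auto
  hence "\<forall>\<^sub>F i in sequentially. \<exists>x y. 0 < infnorm (rvec x) \<and> infnorm (rvec x) \<le> 1 / 2 * X (Suc i) \<and>
      lin_form \<xi> x y < (1 / 2 * X (Suc i)) powr (- w)"
    by (rule eventually_compose_filterlim[OF ev])
  hence "\<forall>\<^sub>F i in sequentially. L i \<le> 2 powr w * X (Suc i) powr (- w)"
  proof eventually_elim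
    case (elim i)
    then obtain x y where xy: "0 < infnorm (rvec x)" "infnorm (rvec x) \<le> 1 / 2 * X (Suc i)"
      "lin_form \<xi> x y < (1 / 2 * X (Suc i)) powr (- w)"
      by blast
    define p where "p = (rvec x, rvec y)"
    have "p \<in> int_points" "p \<noteq> 0" "ht p < X (Suc i)"
      using xy(1,2) X_ge_1[of "Suc i"]
      by (auto simp: p_def int_points_def ht_def infnorm_0 zero_prod_def)
    hence "L i \<le> err \<xi> p" by (rule minimal)
    also have "err \<xi> p = lin_form \<xi> x y" by (simp add: p_def err_def lin_form_def)
    also have "\<dots> \<le> (1 / 2 * X (Suc i)) powr (- w)" using xy(3) by simp
    also have "\<dots> = 2 powr w * X (Suc i) powr (- w)"
      by (simp add: powr_mult powr_divide powr_minus_divide ht_nonneg)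
    finally show ?case .
  qed
  thus thesis using that[of z "2 powr w"] z by simp
qed

theorem theorem8:
  fixes \<xi> :: "real^2^'n"
  shows "(totally_irrational \<xi> \<and> (property_B \<xi> \<or> property_C \<xi>) \<longrightarrow> uniform_exponent \<xi> \<le> 2)
    \<and> (totally_irrational \<xi> \<and> property_B \<xi> \<and> property_C \<xi>
         \<and> \<not> (\<exists>S. rational_subspace S \<and> dim S = 3 \<and> graph_space \<xi> \<subseteq> S)
       \<longrightarrow> uniform_exponent \<xi> \<le> ereal (4 / 3))"
proof (intro conjI impI)
  assume H: "totally_irrational \<xi> \<and> (property_B \<xi> \<or> property_C \<xi>)"
  have "w \<le> 2" if ev: "\<forall>\<^sub>F X in at_top. \<exists>x y. 0 < infnorm (rvec x) \<and> infnorm (rvec x) \<le> X \<and>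
      lin_form \<xi> x y < X powr (- w)" for w
  \<comment> \<open>Exponents up to 1 satisfy the bound trivially; only larger ones make
    \<open>X (Suc i) * L i\<close> tend to 0.\<close>
  proof (cases "1 < w")
    case True
    obtain z c where z: "minimal_points \<xi> z" "\<forall>i. ht (z i) = jump_point \<xi> i"
      "\<forall>i. err \<xi> (z i) = jump_value \<xi> i" "0 < c"
      "\<forall>\<^sub>F i in sequentially. err \<xi> (z i) \<le> c * ht (z (Suc i)) powr (- w)"
      by (rule minimal_points_decay[OF conjunct1[OF H] True ev])
    interpret minimal_points \<xi> z by (rule z(1))
    have "\<exists>R. (\<forall>i. X (Suc i) \<le> R * X i) \<or> (\<forall>i. L i \<le> R * L (Suc i))"
      using H property_B_bound[OF z(2)[rule_format]] property_C_bound[OF z(3)[rule_format]]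
      by (metis order_refl)
    then show ?thesis using exponent_le_2[OF z(5) True z(4)] by blast
  qed simp
  thus "uniform_exponent \<xi> \<le> 2"
    unfolding uniform_exponent_def by (intro Sup_least) auto
next
  assume H: "totally_irrational \<xi> \<and> property_B \<xi> \<and> property_C \<xi>
         \<and> \<not> (\<exists>S. rational_subspace S \<and> dim S = 3 \<and> graph_space \<xi> \<subseteq> S)"
  have "w \<le> 4 / 3" if ev: "\<forall>\<^sub>F X in at_top. \<exists>x y. 0 < infnorm (rvec x) \<and> infnorm (rvec x) \<le> X \<and>
      lin_form \<xi> x y < X powr (- w)" for w
  proof (cases "1 < w")
    case True
    obtain z c where z: "minimal_points \<xi> z" "\<forall>i. ht (z i) = jump_point \<xi> i"
      "\<forall>i. err \<xi> (z i) = jump_value \<xi> i" "0 < c"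
      "\<forall>\<^sub>F i in sequentially. err \<xi> (z i) \<le> c * ht (z (Suc i)) powr (- w)"
      by (rule minimal_points_decay[OF conjunct1[OF H] True ev])
    interpret minimal_points \<xi> z by (rule z(1))
    obtain R where B: "\<And>r i. R \<le> r \<Longrightarrow> X (Suc i) \<le> r * X i"
      using property_B_bound[OF z(2)[rule_format]] H by metis
    obtain R' where C: "\<And>r i. R' \<le> r \<Longrightarrow> L i \<le> r * L (Suc i)"
      using property_C_bound[OF z(3)[rule_format]] H by metis
    \<comment> \<open>One constant serves (B) and (C), and the 1 makes it positive.\<close>
    show ?thesis
      using H by (intro exponent_le_4_3[OF z(5) True z(4), of "max 1 (max R R')"] B C) auto
  qed simp
  thus "uniform_exponent \<xi> \<le> ereal (4 / 3)"
    unfolding uniform_exponent_def by (intro Sup_least) auto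
qed

end
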